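(* There is an algorithm which, given a positive integer $d$, outputs in $O(d^4)$ time a complete implicit list of the canonical integral tetrahedra with diameter $d$. Moreover, there is an algorithm which, given a positive integer $d$, outputs in $O(d^5)$ time a complete implicit list of all canonical integral tetrahedra with diameter at most $d$. In particular, in each list every isomorphism class of integral tetrahedra of the respective diameter(s) is represented exactly once.
   Context: An integral tetrahedron is given by its side lengths $(\delta_{0,1},\delta_{0,2},\delta_{1,2},\delta_{0,3},\delta_{1,3},\delta_{2,3})$, which are positive integers (with $\delta_{i,j}=\delta_{j,i}$) such that there are four affinely independent points $p_0,\dots,p_3\in\mathbb{R}^3$ with $\|p_i-p_j\|=\delta_{i,j}$ for all $i\neq j$. Its diameter is $\max_{i<j}\delta_{i,j}$. Two integral tetrahedra are isomorphic if their side lengths agree after a permutation of the points $0,1,2,3$. A tetrahedron is canonical if $$(\delta_{0,1},\delta_{0,2},\delta_{1,2},\delta_{0,3},\delta_{1,3},\delta_{2,3})\succeq(\delta_{\tau(0),\tau(1)},\delta_{\tau(0),\tau(2)},\delta_{\tau(1),\tau(2)},\delta_{\tau(0),\tau(3)},\delta_{\tau(1),\tau(3)},\delta_{\tau(2),\tau(3)})$$ for all permutations $\tau$ of $\{0,1,2,3\}$, where $\succeq$ is the lexicographic order. An implicit list consists of entries of the form $\delta_{0,1},\delta_{0,2},\delta_{1,2},\delta_{0,3},\delta_{1,3},[\hat l,\hat u]$ with pairwise distinct first five coordinates (as 5-tuples) and integers $\hat l,\hat u$; each entry represents the set of all tetrahedra $(\delta_{0,1},\delta_{0,2},\delta_{1,2},\delta_{0,3},\delta_{1,3},\delta_{2,3})$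 with integer $\delta_{2,3}\in[\hat l,\hat u]$ (possibly empty). Running time counts arithmetic operations (including extraction of square roots), comparisons and printing of one entry at unit cost each. *)

theory Defs
  imports "HOL-Analysis.Analysis" "HOL-Combinatorics.Permutations" "HOL-Library.Landau_Symbols"
begin

section \<open>Integral tetrahedra\<close>

text \<open>The six coordinates are, in this order,
  \<open>\<delta>\<^sub>0\<^sub>1, \<delta>\<^sub>0\<^sub>2, \<delta>\<^sub>1\<^sub>2, \<delta>\<^sub>0\<^sub>3, \<delta>\<^sub>1\<^sub>3, \<delta>\<^sub>2\<^sub>3\<close>.\<close>

type_synonym sides = "int \<times> int \<times> int \<times> int \<times> int \<times> int"

fun side :: "sides \<Rightarrow> nat \<Rightarrow> nat \<Rightarrow> int" where
  "side (d01, d02, d12, d03, d13, d23) i j =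
     (if {i, j} = {0, 1} then d01
      else if {i, j} = {0, 2} then d02
      else if {i, j} = {1, 2} then d12
      else if {i, j} = {0, 3} then d03
      else if {i, j} = {1, 3} then d13
      else if {i, j} = {2, 3} then d23
      else 0)"

definition integral_tetrahedron :: "sides \<Rightarrow> bool" where
  "integral_tetrahedron \<delta> \<longleftrightarrow>
     (\<forall>i<4. \<forall>j<4. i \<noteq> j \<longrightarrow> side \<delta> i j > 0) \<and>
     (\<exists>p :: nat \<Rightarrow> real ^ 3.
        inj_on p {..<4} \<and> \<not> affine_dependent (p ` {..<4}) \<and>
        (\<forall>i<4. \<forall>j<4. i \<noteq> j \<longrightarrow> norm (p i - p j) = of_int (side \<delta> i j)))"

definition tetra_diameter :: "sides \<Rightarrow> int" where
  "tetra_diameter \<delta> = Max {side \<delta> i j | i j. i < j \<and> j < 4}"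

definition relabel :: "(nat \<Rightarrow> nat) \<Rightarrow> sides \<Rightarrow> sides" where
  "relabel \<tau> \<delta> =
     (side \<delta> (\<tau> 0) (\<tau> 1), side \<delta> (\<tau> 0) (\<tau> 2), side \<delta> (\<tau> 1) (\<tau> 2),
      side \<delta> (\<tau> 0) (\<tau> 3), side \<delta> (\<tau> 1) (\<tau> 3), side \<delta> (\<tau> 2) (\<tau> 3))"

definition isomorphic :: "sides \<Rightarrow> sides \<Rightarrow> bool" where
  "isomorphic \<delta> \<delta>' \<longleftrightarrow> (\<exists>\<tau>. \<tau> permutes {..<4} \<and> \<delta>' = relabel \<tau> \<delta>)"

text \<open>The lexicographic order is taken from the list library: the instance of \<open>\<le>\<close> for pairs
  that comes with \<open>HOL-Analysis\<close> is the componentwise order.\<close>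

fun to_list :: "sides \<Rightarrow> int list" where
  "to_list (d01, d02, d12, d03, d13, d23) = [d01, d02, d12, d03, d13, d23]"

definition canonical :: "sides \<Rightarrow> bool" where
  "canonical \<delta> \<longleftrightarrow>
     (\<forall>\<tau>. \<tau> permutes {..<4} \<longrightarrow>
        ord_class.lexordp_eq (to_list (relabel \<tau> \<delta>)) (to_list \<delta>))"


section \<open>Implicit lists\<close>

type_synonym entry = "(int \<times> int \<times> int \<times> int \<times> int) \<times> int \<times> int"

fun represented :: "entry \<Rightarrow> sides set" where
  "represented ((d01, d02, d12, d03, d13), l, u) =
     {(d01, d02, d12, d03, d13, d23) | d23. l \<le> d23 \<and> d23 \<le> u}"

definition complete_implicit_list :: "entry list \<Rightarrow> sides set \<Rightarrow> bool" where
  "complete_implicit_list L S \<longleftrightarrow>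
     distinct (map fst L) \<and> (\<Union>e\<in>set L. represented e) = S"

text \<open>Occurrences are counted together with their position in the list, so that a tetrahedron
  represented by two entries would count twice.\<close>

definition represents_classes_once :: "entry list \<Rightarrow> sides set \<Rightarrow> bool" where
  "represents_classes_once L S \<longleftrightarrow>
     (\<forall>\<delta>\<in>S. card {(k, \<delta>'). k < length L \<and> \<delta>' \<in> represented (L ! k) \<and> isomorphic \<delta> \<delta>'} = 1)"


section \<open>Algorithms and their running time\<close>

text \<open>
  Algorithms are structured programs for a random access machine with integer memory cells,
  under the uniform cost measure. All arithmetic is integer arithmetic: \<open>Quot\<close> is division
  rounded down (with value \<open>0\<close> for divisor \<open>0\<close>) and \<open>Sqrt\<close> is the square root rounded down.
  A machine with exact real division, square roots and rounding simulates each of these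
  operations in a constant number of steps.

  Besides arithmetic operations, comparisons and printing, the cost also includes one unit for
  each memory access and each Boolean connective. As every loop test contains a comparison,
  this changes the running time of a fixed program by at most a constant factor.
\<close>

type_synonym store = "int \<Rightarrow> int"

datatype aexp =
    Num int
  | Cell aexp  \<comment> \<open>content of the cell with the computed address\<close>
  | Plus aexp aexp
  | Minus aexp aexp
  | Times aexp aexp
  | Quot aexp aexp
  | Sqrt aexp

datatype bexp =
    Less aexp aexp
  | Leq aexp aexp
  | Equal aexp aexp
  | Neg bexp
  | Conj bexp bexp

datatype com =
    Skip
  | Assign aexp aexp  \<comment> \<open>address and new content\<close>
  | Seq com com
  | Cond bexp com com
  | While bexp com
  | Print aexp aexp aexp aexp aexp aexp aexp

fun aval :: "aexp \<Rightarrow> store \<Rightarrow> int" where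
  "aval (Num n) s = n"
| "aval (Cell a) s = s (aval a s)"
| "aval (Plus a b) s = aval a s + aval b s"
| "aval (Minus a b) s = aval a s - aval b s"
| "aval (Times a b) s = aval a s * aval b s"
| "aval (Quot a b) s = aval a s div aval b s"
| "aval (Sqrt a) s = \<lfloor>sqrt (real_of_int (aval a s))\<rfloor>"

fun acost :: "aexp \<Rightarrow> nat" where
  "acost (Num n) = 0"
| "acost (Cell a) = acost a + 1"
| "acost (Plus a b) = acost a + acost b + 1"
| "acost (Minus a b) = acost a + acost b + 1"
| "acost (Times a b) = acost a + acost b + 1"
| "acost (Quot a b) = acost a + acost b + 1"
| "acost (Sqrt a) = acost a + 1"

fun bval :: "bexp \<Rightarrow> store \<Rightarrow> bool" where
  "bval (Less a b) s \<longleftrightarrow> aval a s < aval b s"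
| "bval (Leq a b) s \<longleftrightarrow> aval a s \<le> aval b s"
| "bval (Equal a b) s \<longleftrightarrow> aval a s = aval b s"
| "bval (Neg b) s \<longleftrightarrow> \<not> bval b s"
| "bval (Conj b c) s \<longleftrightarrow> bval b s \<and> bval c s"

fun bcost :: "bexp \<Rightarrow> nat" where
  "bcost (Less a b) = acost a + acost b + 1"
| "bcost (Leq a b) = acost a + acost b + 1"
| "bcost (Equal a b) = acost a + acost b + 1"
| "bcost (Neg b) = bcost b + 1"
| "bcost (Conj b c) = bcost b + bcost c + 1"

text \<open>\<open>exec c s t L s'\<close>: started in \<open>s\<close>, the program \<open>c\<close> halts in \<open>s'\<close> after time \<open>t\<close>,
  having printed the entries \<open>L\<close> in this order.\<close>

inductive exec :: "com \<Rightarrow> store \<Rightarrow> nat \<Rightarrow> entry list \<Rightarrow> store \<Rightarrow> bool" where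
  Skip: "exec Skip s 0 [] s"
| Assign: "exec (Assign a b) s (acost a + acost b + 1) [] (s(aval a s := aval b s))"
| Seq: "exec (Seq c1 c2) s (t1 + t2) (L1 @ L2) s''"
    if "exec c1 s t1 L1 s'" and "exec c2 s' t2 L2 s''"
| CondTrue: "exec (Cond b c1 c2) s (bcost b + t) L s'"
    if "bval b s" and "exec c1 s t L s'"
| CondFalse: "exec (Cond b c1 c2) s (bcost b + t) L s'"
    if "\<not> bval b s" and "exec c2 s t L s'"
| WhileFalse: "exec (While b c) s (bcost b) [] s"
    if "\<not> bval b s"
| WhileTrue: "exec (While b c) s (bcost b + t1 + t2) (L1 @ L2) s''"
    if "bval b s" and "exec c s t1 L1 s'" and "exec (While b c) s' t2 L2 s''"
| Print: "exec (Print a1 a2 a3 a4 a5 l u) s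
     (acost a1 + acost a2 + acost a3 + acost a4 + acost a5 + acost l + acost u + 1)
     [((aval a1 s, aval a2 s, aval a3 s, aval a4 s, aval a5 s), aval l s, aval u s)] s"

inductive_cases exec_elims:
  "exec Skip s t L s'"
  "exec (Assign a b) s t L s'"
  "exec (Seq c1 c2) s t L s'"
  "exec (Cond b c1 c2) s t L s'"
  "exec (Print a1 a2 a3 a4 a5 l u) s t L s'"

inductive_cases exec_WhileE: "exec (While b c) s t L s'"

lemma exec_deterministic:
  assumes "exec c s t L s'" and "exec c s u M r"
  shows "u = t \<and> M = L \<and> r = s'"
  using assms
proof (induction arbitrary: u M r rule: exec.induct)
  case (Skip s)
  then show ?case by (rule exec_elims(1)) blast
next
  case (Assign a b s)
  then show ?case by (rule exec_elims(2)) simp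
next
  case (Seq c1 s t1 L1 s' c2 t2 L2 s'')
  from Seq.prems show ?case
  proof (rule exec_elims(3))
    fix u1 M1 q u2 M2
    assume *: "u = u1 + u2" "M = M1 @ M2" "exec c1 s u1 M1 q" "exec c2 q u2 M2 r"
    have 1: "u1 = t1 \<and> M1 = L1 \<and> q = s'"
      by (rule Seq.IH(1)[OF *(3)])
    then have "exec c2 s' u2 M2 r"
      using *(4) by blast
    then have "u2 = t2 \<and> M2 = L2 \<and> r = s''"
      by (rule Seq.IH(2))
    with 1 *(1,2) show ?thesis
      by blast
  qed
next
  case (CondTrue b s c1 t L s' c2)
  from CondTrue.prems show ?case
  proof (rule exec_elims(4))
    fix u1
    assume "u = bcost b + u1" "exec c1 s u1 M r"
    with CondTrue.IH[of u1 M r] show ?thesis by blast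
  next
    assume "\<not> bval b s"
    with CondTrue.hyps(1) show ?thesis by blast
  qed
next
  case (CondFalse b s c2 t L s' c1)
  from CondFalse.prems show ?case
  proof (rule exec_elims(4))
    fix u1
    assume "u = bcost b + u1" "exec c2 s u1 M r"
    with CondFalse.IH[of u1 M r] show ?thesis by blast
  next
    assume "bval b s"
    with CondFalse.hyps(1) show ?thesis by blast
  qed
next
  case (WhileFalse b s c)
  from WhileFalse.prems show ?case
  proof (rule exec_WhileE)
    assume "u = bcost b" "M = []" "r = s"
    then show ?thesis by blast
  next
    assume "bval b s"
    with WhileFalse.hyps show ?thesis by blast
  qed
next
  case (WhileTrue b s c t1 L1 s' t2 L2 s'')
  from WhileTrue.prems show ?case
  proof (rule exec_WhileE)
    assume "\<not> bval b s"
    with WhileTrue.hyps(1) show ?thesis by blast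
  next
    fix u1 M1 q u2 M2
    assume *: "u = bcost b + u1 + u2" "M = M1 @ M2" "exec c s u1 M1 q" "exec (While b c) q u2 M2 r"
    have 1: "u1 = t1 \<and> M1 = L1 \<and> q = s'"
      by (rule WhileTrue.IH(1)[OF *(3)])
    then have "exec (While b c) s' u2 M2 r"
      using *(4) by blast
    then have "u2 = t2 \<and> M2 = L2 \<and> r = s''"
      by (rule WhileTrue.IH(2))
    with 1 *(1,2) show ?thesis
      by blast
  qed
next
  case (Print a1 a2 a3 a4 a5 l w s)
  then show ?case by (rule exec_elims(5)) simp
qed

text \<open>The input is stored in cell \<open>0\<close>; all other cells initially contain \<open>0\<close>.\<close>

definition outputs :: "com \<Rightarrow> nat \<Rightarrow> nat \<Rightarrow> entry list \<Rightarrow> bool" where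
  "outputs P d t L \<longleftrightarrow> (\<exists>s'. exec P ((\<lambda>_. 0)(0 := int d)) t L s')"

end

theory Submission
  imports Defs
begin

text \<open>
  Throughout, \<open>a, b, c, e, f, g\<close> stand for
  \<open>\<delta>\<^sub>0\<^sub>1, \<delta>\<^sub>0\<^sub>2, \<delta>\<^sub>1\<^sub>2, \<delta>\<^sub>0\<^sub>3, \<delta>\<^sub>1\<^sub>3, \<delta>\<^sub>2\<^sub>3\<close>. The theorem rests on one fact: for
  given \<open>a, b, c, e, f\<close> the values of \<open>g\<close> that complete them to a canonical integral tetrahedron
  form an interval, and both of its ends can be found with a bounded number of operations
  (\<open>represented_entries\<close>). There are two reasons for this.

  Canonicity bounds \<open>g\<close> only from above. In the 6-tuple \<open>\<delta>\<close> the value \<open>g\<close> is the last one,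
  whereas in a relabelled tuple it stands at some position, usually an earlier one. Decreasing
  \<open>g\<close> thus makes the relabelled tuple smaller no later than it makes \<open>\<delta>\<close> smaller, and \<open>\<delta>\<close> stays
  canonical. Conversely \<open>g\<close> can be increased as long as it does not catch up with one of the other
  sides (\<open>canonical_move\<close>). Hence the largest admissible value is a side, a side minus one, or the
  bound that comes from geometry, and finitely many candidates have to be tested
  (\<open>canonical_interval\<close>).

  Geometrically, the triangles \<open>012\<close> and \<open>013\<close> are hinged along the edge \<open>01\<close>. If \<open>Y\<close> and \<open>Z\<close> are
  four times their areas and \<open>\<theta>\<close> is the dihedral angle at the hinge, then
  \<open>4 a\<^sup>2 g\<^sup>2 = N - 2 Y Z cos \<theta>\<close>, where \<open>N\<close> depends on \<open>a, b, c, e, f\<close> only. A tetrahedron exists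
  precisely if both triangles are proper and \<open>\<bar>4 a\<^sup>2 g\<^sup>2 - N\<bar> < 2 Y Z\<close>
  (\<open>integral_tetrahedron_iff\<close>). As \<open>N\<close> and \<open>Y\<^sup>2 Z\<^sup>2\<close> are integers, integer square roots and divisions
  turn this condition into exact integer bounds for \<open>g\<close> (\<open>nondegenerate_interval\<close>).

  The first side of a canonical tetrahedron is its diameter. For a given diameter \<open>d\<close> it therefore
  suffices to run through \<open>a = d\<close> and \<open>1 \<le> b, c, e, f \<le> d\<close> in four nested loops and to print one
  interval each time, which takes time \<open>O(d\<^sup>4)\<close>; one more loop over \<open>a\<close> handles all diameters up to
  \<open>d\<close> in time \<open>O(d\<^sup>5)\<close>. Every isomorphism class has exactly one canonical member, namely its
  lexicographic maximum, so a complete list of canonical tetrahedra meets each class exactly once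
  (\<open>represents_classes_once_canonical\<close>).
\<close>

section \<open>Relabelling the vertices\<close>

lemma all_less_4: "(\<forall>i<4. P i) \<longleftrightarrow> P 0 \<and> P 1 \<and> P 2 \<and> P (3::nat)"
  by (auto simp: numeral_eq_Suc less_Suc_eq)

lemma side_commute: "side \<delta> i j = side \<delta> j i"
  by (cases \<delta>) (simp only: side.simps insert_commute)

lemma side_diag: "side \<delta> i i = 0"
  by (cases \<delta>) auto

lemma side_relabel:
  assumes "i < 4" "j < 4"
  shows "side (relabel \<tau> \<delta>) i j = side \<delta> (\<tau> i) (\<tau> j)"
proof -
  have "\<forall>i<4. \<forall>j<4. side (relabel \<tau> \<delta>) i j = side \<delta> (\<tau> i) (\<tau> j)"
    unfolding all_less_4 by (simp add: relabel_def side_diag doubleton_eq_iff) (metis side_commute)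
  then show ?thesis using assms by blast
qed

lemma relabel_id: "relabel id \<delta> = \<delta>"
  by (cases \<delta>) (simp add: relabel_def doubleton_eq_iff)

lemma permutes_less_4:
  fixes \<tau> :: "nat \<Rightarrow> nat"
  shows "\<tau> permutes {..<4} \<Longrightarrow> i < 4 \<Longrightarrow> \<tau> i < 4"
  using permutes_in_image[of \<tau> "{..<4}" i] by simp

lemma relabel_relabel:
  assumes "\<sigma> permutes {..<4}"
  shows "relabel \<sigma> (relabel \<tau> \<delta>) = relabel (\<tau> \<circ> \<sigma>) \<delta>"
  using permutes_less_4[OF assms]
  by (subst (1 3) relabel_def) (simp add: side_relabel)

lemma isomorphic_sym: "isomorphic \<delta> \<delta>' \<Longrightarrow> isomorphic \<delta>' \<delta>"
  unfolding isomorphic_def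
  by (metis permutes_inv permutes_inv_o(1) relabel_id relabel_relabel)

lemma isomorphic_trans: "isomorphic \<delta> \<delta>' \<Longrightarrow> isomorphic \<delta>' \<delta>'' \<Longrightarrow> isomorphic \<delta> \<delta>''"
proof -
  assume "isomorphic \<delta> \<delta>'" "isomorphic \<delta>' \<delta>''"
  then obtain \<tau> \<sigma> where "\<tau> permutes {..<4}" "\<sigma> permutes {..<4}"
    "\<delta>'' = relabel \<sigma> (relabel \<tau> \<delta>)"
    unfolding isomorphic_def by blast
  then have "\<tau> \<circ> \<sigma> permutes {..<4}" "\<delta>'' = relabel (\<tau> \<circ> \<sigma>) \<delta>"
    by (simp_all add: permutes_compose relabel_relabel)
  then show ?thesis unfolding isomorphic_def by blast
qed

lemma integral_tetrahedron_relabel: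
  assumes \<tau>: "\<tau> permutes {..<4}" and \<delta>: "integral_tetrahedron \<delta>"
  shows "integral_tetrahedron (relabel \<tau> \<delta>)"
proof -
  obtain p :: "nat \<Rightarrow> real ^ 3" where
    p: "inj_on p {..<4} \<and> \<not> affine_dependent (p ` {..<4}) \<and>
        (\<forall>i<4. \<forall>j<4. i \<noteq> j \<longrightarrow> norm (p i - p j) = of_int (side \<delta> i j))"
    by (rule exE[OF conjunct2[OF \<delta>[unfolded integral_tetrahedron_def]]])
  have pos: "\<forall>i<4. \<forall>j<4. i \<noteq> j \<longrightarrow> side \<delta> i j > 0"
    by (rule conjunct1[OF \<delta>[unfolded integral_tetrahedron_def]])
  have im: "\<tau> ` {..<4} = {..<4}" using \<tau> by (rule permutes_image)
  have neq: "\<tau> i \<noteq> \<tau> j" if "i \<noteq> j" for i j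
    using that permutes_inj[OF \<tau>] by (auto dest: injD)
  have "inj_on (p \<circ> \<tau>) {..<4}"
    using p im permutes_inj_on[OF \<tau>] by (intro comp_inj_on) auto
  moreover have "(p \<circ> \<tau>) ` {..<4} = p ` {..<4}" by (metis im image_comp)
  moreover have "norm ((p \<circ> \<tau>) i - (p \<circ> \<tau>) j) = of_int (side (relabel \<tau> \<delta>) i j)"
    "side (relabel \<tau> \<delta>) i j > 0" if "i < 4" "j < 4" "i \<noteq> j" for i j
    using p pos neq[OF that(3)] permutes_less_4[OF \<tau>] that by (simp_all add: side_relabel)
  ultimately show ?thesis
    unfolding integral_tetrahedron_def using p by (intro conjI exI[of _ "p \<circ> \<tau>"]) simp_all
qed

lemma tetra_diameter_le_iff:
  "tetra_diameter \<delta> \<le> m \<longleftrightarrow> (\<forall>i<4. \<forall>j<4. i \<noteq> j \<longrightarrow> side \<delta> i j \<le> m)"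
proof -
  have eq: "{side \<delta> i j | i j. i < j \<and> j < 4} = (\<lambda>(i, j). side \<delta> i j) ` {(i, j). i < j \<and> j < 4}"
    by auto
  have "{(i, j). i < j \<and> j < (4::nat)} \<subseteq> {..<4} \<times> {..<4}" by auto
  then have "finite {(i, j). i < j \<and> j < (4::nat)}"
    by (rule finite_subset) simp
  then have fin: "finite {side \<delta> i j | i j. i < j \<and> j < 4}" unfolding eq by simp
  have "side \<delta> 0 1 \<in> {side \<delta> i j | i j. i < j \<and> j < 4}" by force
  then have ne: "{side \<delta> i j | i j. i < j \<and> j < 4} \<noteq> {}" by blast
  have "tetra_diameter \<delta> \<le> m \<longleftrightarrow> (\<forall>i j. i < j \<and> j < 4 \<longrightarrow> side \<delta> i j \<le> m)"
    unfolding tetra_diameter_def Max_le_iff[OF fin ne] by auto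
  also have "\<dots> \<longleftrightarrow> (\<forall>i<4. \<forall>j<4. i \<noteq> j \<longrightarrow> side \<delta> i j \<le> m)"
  proof (intro iffI allI impI)
    fix i j :: nat
    assume *: "\<forall>i j. i < j \<and> j < 4 \<longrightarrow> side \<delta> i j \<le> m" and "i < 4" "j < 4" "i \<noteq> j"
    then show "side \<delta> i j \<le> m"
      using *[rule_format, of i j] *[rule_format, of j i] side_commute[of \<delta> i j]
      by (cases "i < j") auto
  qed auto
  finally show ?thesis .
qed

lemma side_le_tetra_diameter: "i < 4 \<Longrightarrow> j < 4 \<Longrightarrow> i \<noteq> j \<Longrightarrow> side \<delta> i j \<le> tetra_diameter \<delta>"
  using iffD1[OF tetra_diameter_le_iff order_refl] by blast

lemma tetra_diameter_relabel_le:
  assumes "\<tau> permutes {..<4}"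
  shows "tetra_diameter (relabel \<tau> \<delta>) \<le> tetra_diameter \<delta>"
  unfolding tetra_diameter_le_iff
proof (intro allI impI)
  fix i j :: nat assume "i < 4" "j < 4" "i \<noteq> j"
  then have "\<tau> i < 4" "\<tau> j < 4" "\<tau> i \<noteq> \<tau> j"
    using permutes_less_4[OF assms] permutes_inj[OF assms] by (auto dest: injD)
  then show "side (relabel \<tau> \<delta>) i j \<le> tetra_diameter \<delta>"
    using \<open>i < 4\<close> \<open>j < 4\<close> by (simp add: side_relabel side_le_tetra_diameter)
qed

lemma isomorphic_invariants:
  assumes "isomorphic \<delta> \<delta>'"
  shows "integral_tetrahedron \<delta>' \<longleftrightarrow> integral_tetrahedron \<delta>"
    and "tetra_diameter \<delta>' = tetra_diameter \<delta>"
proof -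
  obtain \<tau> where \<tau>: "\<tau> permutes {..<4}" "\<delta>' = relabel \<tau> \<delta>"
    using assms unfolding isomorphic_def by (elim exE conjE)
  obtain \<sigma> where \<sigma>: "\<sigma> permutes {..<4}" "\<delta> = relabel \<sigma> \<delta>'"
    using isomorphic_sym[OF assms] unfolding isomorphic_def by (elim exE conjE)
  show "integral_tetrahedron \<delta>' \<longleftrightarrow> integral_tetrahedron \<delta>"
    using integral_tetrahedron_relabel[OF \<tau>(1), of \<delta>, folded \<tau>(2)]
      integral_tetrahedron_relabel[OF \<sigma>(1), of \<delta>', folded \<sigma>(2)] by (rule iffI[rotated])
  show "tetra_diameter \<delta>' = tetra_diameter \<delta>"
    using tetra_diameter_relabel_le[OF \<tau>(1), of \<delta>, folded \<tau>(2)]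
      tetra_diameter_relabel_le[OF \<sigma>(1), of \<delta>', folded \<sigma>(2)] by (rule antisym)
qed

section \<open>Canonical representatives\<close>

lemma to_list_inject: "to_list \<delta> = to_list \<delta>' \<longleftrightarrow> \<delta> = \<delta>'"
  by (cases \<delta>; cases \<delta>') simp

lemma canonical_iff:
  "canonical \<delta> \<longleftrightarrow> (\<forall>\<delta>'. isomorphic \<delta> \<delta>' \<longrightarrow> ord_class.lexordp_eq (to_list \<delta>') (to_list \<delta>))"
proof (intro iffI allI impI)
  fix \<delta>' assume "canonical \<delta>" "isomorphic \<delta> \<delta>'"
  from this(2) obtain \<tau> where "\<tau> permutes {..<4}" "\<delta>' = relabel \<tau> \<delta>"
    unfolding isomorphic_def by (elim exE conjE)
  with \<open>canonical \<delta>\<close> show "ord_class.lexordp_eq (to_list \<delta>') (to_list \<delta>)"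
    by (simp add: canonical_def)
next
  assume *: "\<forall>\<delta>'. isomorphic \<delta> \<delta>' \<longrightarrow> ord_class.lexordp_eq (to_list \<delta>') (to_list \<delta>)"
  show "canonical \<delta>"
    unfolding canonical_def
  proof (intro allI impI)
    fix \<tau> :: "nat \<Rightarrow> nat" assume "\<tau> permutes {..<4}"
    then have "isomorphic \<delta> (relabel \<tau> \<delta>)"
      unfolding isomorphic_def by (intro exI[of _ \<tau>] conjI refl)
    then show "ord_class.lexordp_eq (to_list (relabel \<tau> \<delta>)) (to_list \<delta>)"
      by (rule *[rule_format])
  qed
qed

lemma canonical_unique:
  assumes "canonical \<delta>" "canonical \<delta>'" "isomorphic \<delta> \<delta>'"
  shows "\<delta> = \<delta>'"
proof -
  have "ord_class.lexordp_eq (to_list \<delta>') (to_list \<delta>)"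
    using assms(1,3) unfolding canonical_iff by (elim allE impE)
  moreover have "ord_class.lexordp_eq (to_list \<delta>) (to_list \<delta>')"
    using assms(2) isomorphic_sym[OF assms(3)] unfolding canonical_iff by (elim allE impE)
  ultimately show ?thesis
    using lexordp_eq_antisym to_list_inject by metis
qed

text \<open>An isomorphism class is finite and the lexicographic order is total, so each class has a maximum.\<close>

lemma canonical_exists: "\<exists>\<delta>'. isomorphic \<delta> \<delta>' \<and> canonical \<delta>'"
proof -
  let ?R = "\<lambda>x y. ord_class.lexordp (to_list x) (to_list y)"
  define C where "C = {\<delta>'. isomorphic \<delta> \<delta>'}"
  have "C = (\<lambda>\<tau>. relabel \<tau> \<delta>) ` {\<tau>. \<tau> permutes {..<4}}"
    unfolding C_def isomorphic_def by blast
  then have fin: "finite C" by (simp add: finite_permutations)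
  have "isomorphic \<delta> \<delta>"
    unfolding isomorphic_def by (intro exI[of _ id] conjI) (simp_all only: permutes_id relabel_id)
  then have ne: "C \<noteq> {}" unfolding C_def by blast
  have trans: "transp_on C ?R" by (rule transp_onI) (rule lexordp_trans)
  have total: "totalp_on C ?R"
    by (rule totalp_onI) (metis lexordp_linear to_list_inject)
  from Finite_Set.bex_greatest_element[OF fin ne trans total]
  obtain m where m: "m \<in> C" and greatest: "\<forall>x\<in>C. x \<noteq> m \<longrightarrow> ?R x m" by (rule bexE)
  have "canonical m"
    unfolding canonical_iff
  proof (intro allI impI)
    fix x assume "isomorphic m x"
    with m have "x \<in> C" unfolding C_def mem_Collect_eq by (rule isomorphic_trans)
    with greatest have "x = m \<or> ?R x m" by blast
    then show "ord_class.lexordp_eq (to_list x) (to_list m)"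
      by (elim disjE) (simp_all only: lexordp_eq_refl lexordp_into_lexordp_eq)
  qed
  with m show ?thesis unfolding C_def mem_Collect_eq by (intro exI[of _ m] conjI)
qed

text \<open>Entries with different 5-tuples represent disjoint sets, so distinctness of the 5-tuples fixes
  the position in the list, and uniqueness of the canonical representative fixes the tetrahedron.\<close>

lemma represents_classes_once_canonical:
  assumes L: "complete_implicit_list L {\<delta>. integral_tetrahedron \<delta> \<and> canonical \<delta> \<and> P (tetra_diameter \<delta>)}"
  shows "represents_classes_once L {\<delta>. integral_tetrahedron \<delta> \<and> P (tetra_diameter \<delta>)}"
  unfolding represents_classes_once_def
proof
  fix \<delta> assume \<delta>: "\<delta> \<in> {\<delta>. integral_tetrahedron \<delta> \<and> P (tetra_diameter \<delta>)}"
  have repr: "(\<exists>k<length L. \<delta>' \<in> represented (L ! k)) \<longleftrightarrow>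
      integral_tetrahedron \<delta>' \<and> canonical \<delta>' \<and> P (tetra_diameter \<delta>')" for \<delta>'
  proof -
    have "(\<Union>e\<in>set L. represented e)
        = {\<delta>. integral_tetrahedron \<delta> \<and> canonical \<delta> \<and> P (tetra_diameter \<delta>)}"
      using L by (simp add: complete_implicit_list_def)
    then have "\<delta>' \<in> (\<Union>e\<in>set L. represented e) \<longleftrightarrow>
        integral_tetrahedron \<delta>' \<and> canonical \<delta>' \<and> P (tetra_diameter \<delta>')" by blast
    moreover have "\<delta>' \<in> (\<Union>e\<in>set L. represented e) \<longleftrightarrow> (\<exists>k<length L. \<delta>' \<in> represented (L ! k))"
      by (simp only: UN_iff Bex_def in_set_conv_nth) (metis (lifting))
    ultimately show ?thesis by (simp only:)
  qed
  have tag: "\<delta>' \<in> represented e \<Longrightarrow> \<delta>' \<in> represented e' \<Longrightarrow> fst e = fst e'" for \<delta>' e e'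
    by (cases e rule: represented.cases; cases e' rule: represented.cases) auto
  obtain \<delta>' where \<delta>': "isomorphic \<delta> \<delta>'" "canonical \<delta>'"
    using canonical_exists by blast
  then obtain k where k: "k < length L" "\<delta>' \<in> represented (L ! k)"
    using repr[of \<delta>'] \<delta> isomorphic_invariants[OF \<delta>'(1)] by auto
  have "i = k \<and> x = \<delta>'"
    if i: "i < length L" "x \<in> represented (L ! i)" "isomorphic \<delta> x" for i x
  proof -
    have "canonical x" using repr[of x] i by blast
    moreover have "isomorphic x \<delta>'"
      using isomorphic_trans[OF isomorphic_sym[OF i(3)] \<delta>'(1)] .
    ultimately have x: "x = \<delta>'" using canonical_unique \<delta>'(2) by blast
    have "fst (L ! i) = fst (L ! k)" using tag i(2) k(2) unfolding x by blast
    moreover have "distinct (map fst L)" using L by (simp add: complete_implicit_list_def)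
    ultimately have "i = k"
      using i(1) k(1) nth_eq_iff_index_eq[of "map fst L" i k] by simp
    with x show ?thesis by blast
  qed
  then have "{(k, \<delta>'). k < length L \<and> \<delta>' \<in> represented (L ! k) \<and> isomorphic \<delta> \<delta>'} = {(k, \<delta>')}"
    using k \<delta>'(1) by blast
  then show "card {(k, \<delta>'). k < length L \<and> \<delta>' \<in> represented (L ! k) \<and> isomorphic \<delta> \<delta>'} = 1"
    by (simp only: card.empty card_insert_disjoint finite.emptyI empty_iff not_False_eq_True One_nat_def)
qed

section \<open>The effect of the last side on canonicity\<close>

text \<open>Here \<open>zs @ [g]\<close> is a tuple of sides and \<open>xs @ g # ys\<close> one of its relabellings. If the comparison
  is decided before \<open>g\<close> is reached on the left, \<open>g\<close> does not enter it. Otherwise \<open>g\<close> meets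
  itself in the last place, or some \<open>z\<close> in \<open>zs\<close> with \<open>g \<le> z\<close>; the hypothesis on \<open>h\<close> keeps a strict inequality strict and
  either preserves an equality or makes it strict. It holds for every \<open>h \<le> g\<close>, and also for some
  larger \<open>h\<close>.\<close>

lemma lexordp_eq_move:
  fixes g h :: int
  assumes "\<forall>z\<in>set zs. (g < z \<longrightarrow> h < z) \<and> (g = z \<longrightarrow> h \<le> z)"
    and "length xs + length ys = length zs"
    and "ord_class.lexordp_eq (xs @ g # ys) (zs @ [g])"
  shows "ord_class.lexordp_eq (xs @ h # ys) (zs @ [h])"
  using assms
proof (induction xs arbitrary: zs)
  case Nil
  show ?case
  proof (cases zs)
    case (Cons z zs')
    from Nil(3) Cons have "g < z \<or> \<not> z < g \<and> ord_class.lexordp_eq ys (zs' @ [g])" by simp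
    then consider "g < z" | "g = z" "ord_class.lexordp_eq ys (zs' @ [g])" by fastforce
    then show ?thesis
    proof cases
      case 2
      then have "h < z \<or> h = z" using Nil(1) unfolding Cons by fastforce
      then show ?thesis using 2 unfolding Cons by auto
    next
      case 1
      then show ?thesis using Nil(1) unfolding Cons by simp
    qed
  qed (use Nil(2) in simp)
next
  case (Cons x xs)
  then obtain z zs' where zs: "zs = z # zs'" by (cases zs) auto
  have "ord_class.lexordp_eq (xs @ h # ys) (zs' @ [h])"
    if "ord_class.lexordp_eq (xs @ g # ys) (zs' @ [g])"
    using Cons.IH[of zs'] Cons.prems(1,2) that unfolding zs by simp
  then show ?case using Cons.prems(3) unfolding zs by auto
qed

lemma side_last:
  "side (a, b, c, e, f, g) m n = (if {m, n} = {2, 3} then g else side (a, b, c, e, f, 0) m n)"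
  by (simp add: doubleton_eq_iff)

text \<open>The vertices \<open>i, j\<close> sent to \<open>2, 3\<close> name the edge at which the last side reappears. The other five
  sides of the relabelled tuple do not involve \<open>g\<close>.\<close>

lemma relabel_last_side:
  assumes \<tau>: "\<tau> permutes {..<4}"
  obtains xs ys where "length xs + length ys = 5"
    "\<And>g. to_list (relabel \<tau> (a, b, c, e, f, g)) = xs @ g # ys"
proof -
  define r where "r i j = side (a, b, c, e, f, 0) (\<tau> i) (\<tau> j)" for i j
  obtain i j where ij: "i < 4" "j < 4" "\<tau> i = 2" "\<tau> j = 3"
  proof -
    have "2 \<in> \<tau> ` {..<4}" "3 \<in> \<tau> ` {..<4}" unfolding permutes_image[OF \<tau>] by simp_all
    then show thesis using that by (elim imageE) simp
  qed
  have "inj \<tau>" using \<tau> by (rule permutes_inj)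
  have g: "side (a, b, c, e, f, g) (\<tau> k) (\<tau> l) = (if {k, l} = {i, j} then g else r k l)" for g k l
  proof -
    have "{\<tau> k, \<tau> l} = {2, 3} \<longleftrightarrow> {k, l} = {i, j}"
      using inj_image_eq_iff[OF \<open>inj \<tau>\<close>, of "{k, l}" "{i, j}"]
      unfolding ij(3,4)[symmetric] by (simp only: image_insert image_empty)
    then show ?thesis unfolding side_last[of a b c e f g] r_def by (simp only:)
  qed
  have "i \<noteq> j" using ij by auto
  have "\<exists>xs ys. length xs + length ys = 5 \<and>
     (\<forall>g. to_list (relabel \<tau> (a, b, c, e, f, g)) = xs @ g # ys)"
  proof -
    let ?L = "[r 0 1, r 0 2, r 1 2, r 0 3, r 1 3, r 2 3]"
    have "\<exists>k<6. \<forall>g. to_list (relabel \<tau> (a, b, c, e, f, g)) = take k ?L @ g # drop (Suc k) ?L"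
    proof -
      have "i \<in> {0, 1, 2, 3}" "j \<in> {0, 1, 2, 3}" using ij(1,2) by auto
      then have "{i, j} = {0, 1} \<or> {i, j} = {0, 2} \<or> {i, j} = {1, 2} \<or> {i, j} = {0, 3} \<or>
          {i, j} = {1, 3} \<or> {i, j} = {2, 3}"
        using \<open>i \<noteq> j\<close> by (elim insertE emptyE) (simp_all add: doubleton_eq_iff)
      then show ?thesis
      proof (elim disjE, goal_cases)
        case 1
        show ?thesis
          by (intro exI[of _ 0]) (simp add: relabel_def g[unfolded 1] doubleton_eq_iff del: side.simps)
      next
        case 2
        show ?thesis
          by (intro exI[of _ 1]) (simp add: relabel_def g[unfolded 2] doubleton_eq_iff del: side.simps)
      next
        case 3
        show ?thesis
          by (intro exI[of _ 2]) (simp add: relabel_def g[unfolded 3] doubleton_eq_iff del: side.simps)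
      next
        case 4
        show ?thesis
          by (intro exI[of _ 3]) (simp add: relabel_def g[unfolded 4] doubleton_eq_iff del: side.simps)
      next
        case 5
        show ?thesis
          by (intro exI[of _ 4]) (simp add: relabel_def g[unfolded 5] doubleton_eq_iff del: side.simps)
      next
        case 6
        show ?thesis
          by (intro exI[of _ 5]) (simp add: relabel_def g[unfolded 6] doubleton_eq_iff del: side.simps)
      qed
    qed
    then obtain k where "k < 6"
      "\<forall>g. to_list (relabel \<tau> (a, b, c, e, f, g)) = take k ?L @ g # drop (Suc k) ?L" by blast
    then show ?thesis
      by (intro exI[of _ "take k ?L"] exI[of _ "drop (Suc k) ?L"]) simp
  qed
  then show thesis using that by blast
qed

lemma canonical_move:
  assumes "canonical (a, b, c, e, f, g)"
    and "\<forall>z\<in>{a, b, c, e, f}. (g < z \<longrightarrow> h < z) \<and> (g = z \<longrightarrow> h \<le> z)"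
  shows "canonical (a, b, c, e, f, h)"
  unfolding canonical_def
proof (intro allI impI)
  fix \<tau> :: "nat \<Rightarrow> nat" assume \<tau>: "\<tau> permutes {..<4}"
  obtain xs ys where xy: "length xs + length ys = 5"
    "\<And>g. to_list (relabel \<tau> (a, b, c, e, f, g)) = xs @ g # ys"
    using relabel_last_side[OF \<tau>] by blast
  have "ord_class.lexordp_eq (xs @ g # ys) ([a, b, c, e, f] @ [g])"
    using assms(1) \<tau> xy(2)[of g] by (auto simp: canonical_def)
  then have "ord_class.lexordp_eq (xs @ h # ys) ([a, b, c, e, f] @ [h])"
    by (rule lexordp_eq_move[rotated 2]) (use assms(2) xy(1) in simp_all)
  then show "ord_class.lexordp_eq (to_list (relabel \<tau> (a, b, c, e, f, h))) (to_list (a, b, c, e, f, h))"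
    by (simp add: xy(2))
qed

lemma permutation_of_4:
  assumes "distinct [i, j, k, l]" "set [i, j, k, l] \<subseteq> {..<4::nat}"
  shows "\<exists>\<tau>. \<tau> permutes {..<4} \<and> \<tau> 0 = i \<and> \<tau> 1 = j \<and> \<tau> 2 = k \<and> \<tau> 3 = l"
proof -
  define \<tau> where "\<tau> n = (if n < 4 then [i, j, k, l] ! n else n)" for n
  have "card (set [i, j, k, l]) = card {..<4::nat}"
    using distinct_card[OF assms(1)] by simp
  then have "set [i, j, k, l] = {..<4}"
    using assms(2) by (metis card_subset_eq finite_lessThan)
  then have "bij_betw ((!) [i, j, k, l]) {..<4} {..<4}"
    using assms(1) by (intro bij_betw_nth) auto
  then have "bij_betw \<tau> {..<4} {..<4}"
    by (rule bij_betw_cong[THEN iffD1, rotated]) (simp add: \<tau>_def)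
  then have "\<tau> permutes {..<4}"
    by (rule bij_imp_permutes) (simp add: \<tau>_def)
  then show ?thesis by (intro exI[of _ \<tau>]) (simp add: \<tau>_def)
qed

text \<open>The quadruples \<open>(\<tau> 0, \<tau> 1, \<tau> 2, \<tau> 3)\<close> of all permutations \<open>\<tau>\<close>, as an explicit list from which a
  program can be generated.\<close>

definition labellings :: "(nat \<times> nat \<times> nat \<times> nat) list" where
  "labellings = filter (\<lambda>(i, j, k, l). distinct [i, j, k, l])
     (List.product [0..<4] (List.product [0..<4] (List.product [0..<4] [0..<4])))"

lemma set_labellings:
  "set labellings = {(i, j, k, l). distinct [i, j, k, l] \<and> set [i, j, k, l] \<subseteq> {..<4}}"
  unfolding labellings_def set_filter set_product set_upt by auto

lemma canonical_labellings:
  "canonical \<delta> \<longleftrightarrow> (\<forall>(i, j, k, l)\<in>set labellings. ord_class.lexordp_eq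
     [side \<delta> i j, side \<delta> i k, side \<delta> j k, side \<delta> i l, side \<delta> j l, side \<delta> k l] (to_list \<delta>))"
proof -
  define P where "P i j k l \<longleftrightarrow> ord_class.lexordp_eq
    [side \<delta> i j, side \<delta> i k, side \<delta> j k, side \<delta> i l, side \<delta> j l, side \<delta> k l] (to_list \<delta>)" for i j k l
  have "canonical \<delta> \<longleftrightarrow> (\<forall>\<tau>. \<tau> permutes {..<4} \<longrightarrow> P (\<tau> 0) (\<tau> 1) (\<tau> 2) (\<tau> 3))"
    by (simp add: canonical_def relabel_def P_def)
  also have "\<dots> \<longleftrightarrow> (\<forall>i j k l :: nat. distinct [i, j, k, l] \<and> set [i, j, k, l] \<subseteq> {..<4} \<longrightarrow> P i j k l)"
  proof (intro iffI allI impI)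
    fix \<tau> :: "nat \<Rightarrow> nat"
    assume *: "\<forall>i j k l :: nat. distinct [i, j, k, l] \<and> set [i, j, k, l] \<subseteq> {..<4} \<longrightarrow> P i j k l"
      and \<tau>: "\<tau> permutes {..<4}"
    have "distinct [\<tau> 0, \<tau> 1, \<tau> 2, \<tau> 3]"
      by (simp add: inj_eq[OF permutes_inj[OF \<tau>]])
    then show "P (\<tau> 0) (\<tau> 1) (\<tau> 2) (\<tau> 3)"
      using permutes_less_4[OF \<tau>] by (intro *[rule_format]) simp
  next
    fix i j k l :: nat
    assume *: "\<forall>\<tau>. \<tau> permutes {..<4} \<longrightarrow> P (\<tau> 0) (\<tau> 1) (\<tau> 2) (\<tau> 3)"
      and d: "distinct [i, j, k, l] \<and> set [i, j, k, l] \<subseteq> {..<4}"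
    then obtain \<tau> where \<tau>: "\<tau> permutes {..<4}" "\<tau> 0 = i \<and> \<tau> 1 = j \<and> \<tau> 2 = k \<and> \<tau> 3 = l"
      using permutation_of_4[of i j k l] by blast
    from *[rule_format, OF \<tau>(1)] \<tau>(2) show "P i j k l" by simp
  qed
  also have "\<dots> \<longleftrightarrow> (\<forall>(i, j, k, l)\<in>set labellings. P i j k l)"
    by (simp only: set_labellings Ball_def split_paired_All case_prod_conv mem_Collect_eq)
  finally show ?thesis unfolding P_def .
qed

section \<open>Which side lengths belong to a tetrahedron\<close>

lemma affine_dependent_4:
  fixes p :: "nat \<Rightarrow> 'a::real_vector"
  assumes "inj_on p {..<4}"
  shows "affine_dependent (p ` {..<4}) \<longleftrightarrow> (\<exists>x y z. (x, y, z) \<noteq> (0, 0, 0) \<and>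
     x *\<^sub>R (p 1 - p 0) + y *\<^sub>R (p 2 - p 0) + z *\<^sub>R (p 3 - p 0) = 0)"
proof -
  have 4: "{..<4} = {0, 1, 2, 3::nat}" by auto
  have sum: "sum h (p ` {..<4}) = h (p 0) + h (p 1) + h (p 2) + h (p 3)" for h :: "'a \<Rightarrow> 'b::ab_group_add"
    unfolding sum.reindex[OF assms] by (simp add: 4 add_ac)
  have "affine_dependent (p ` {..<4}) \<longleftrightarrow>
      (\<exists>U. sum U (p ` {..<4}) = 0 \<and> (\<exists>v\<in>p ` {..<4}. U v \<noteq> 0) \<and>
           sum (\<lambda>v. U v *\<^sub>R v) (p ` {..<4}) = 0)"
    by (rule affine_dependent_explicit_finite) simp
  also have "\<dots> \<longleftrightarrow> (\<exists>x y z. (x, y, z) \<noteq> (0, 0, 0) \<and>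
     x *\<^sub>R (p 1 - p 0) + y *\<^sub>R (p 2 - p 0) + z *\<^sub>R (p 3 - p 0) = 0)" (is "?l \<longleftrightarrow> ?r")
  proof
    assume ?l
    then obtain U where U: "U (p 0) + U (p 1) + U (p 2) + U (p 3) = 0" "\<exists>v\<in>p ` {..<4}. U v \<noteq> 0"
      "U (p 0) *\<^sub>R p 0 + U (p 1) *\<^sub>R p 1 + U (p 2) *\<^sub>R p 2 + U (p 3) *\<^sub>R p 3 = 0"
      unfolding sum by blast
    from U(1) have U0: "U (p 0) = - (U (p 1) + U (p 2) + U (p 3))" by linarith
    show ?r
    proof (intro exI conjI)
      show "(U (p 1), U (p 2), U (p 3)) \<noteq> (0, 0, 0)"
        using U(2) U0 by (auto simp: 4)
      show "U (p 1) *\<^sub>R (p 1 - p 0) + U (p 2) *\<^sub>R (p 2 - p 0) + U (p 3) *\<^sub>R (p 3 - p 0) = 0"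
        using U(3) unfolding U0 by (simp add: algebra_simps)
    qed
  next
    assume ?r
    then obtain x y z where r: "(x, y, z) \<noteq> (0, 0, 0)"
      "x *\<^sub>R (p 1 - p 0) + y *\<^sub>R (p 2 - p 0) + z *\<^sub>R (p 3 - p 0) = 0" by blast
    \<comment> \<open>the weight of a point is looked up by its index; the one of \<open>p 0\<close> makes the sum vanish\<close>
    define U where "U v = [- (x + y + z), x, y, z] ! inv_into {..<4} p v" for v
    have U: "U (p i) = [- (x + y + z), x, y, z] ! i" if "i < 4" for i
      using that assms by (simp add: U_def)
    have "(\<exists>v\<in>p ` {..<4}. U v \<noteq> 0)"
      using r(1) U[of 1] U[of 2] U[of 3] by (auto simp: 4)
    then show ?l
      using r(2) by (intro exI[of _ U]) (simp add: sum U algebra_simps)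
  qed
  finally show ?thesis .
qed

lemma strict_Cauchy_Schwarz:
  fixes v w :: "'a::real_inner"
  assumes indep: "\<And>x y. x *\<^sub>R v + y *\<^sub>R w = 0 \<Longrightarrow> x = 0 \<and> y = 0"
  shows "(v \<bullet> w)\<^sup>2 < (v \<bullet> v) * (w \<bullet> w)"
proof -
  have "v \<bullet> v > 0" using indep[of 1 0] by auto
  \<comment> \<open>\<open>v \<bullet> v\<close> times the component of \<open>w\<close> orthogonal to \<open>v\<close>\<close>
  define q where "q = (- (v \<bullet> w)) *\<^sub>R v + (v \<bullet> v) *\<^sub>R w"
  have "q \<noteq> 0" using indep[of "- (v \<bullet> w)" "v \<bullet> v"] \<open>v \<bullet> v > 0\<close> by (auto simp: q_def)
  then have "0 < q \<bullet> q" by simp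
  also have "q \<bullet> q = (v \<bullet> v) * ((v \<bullet> v) * (w \<bullet> w) - (v \<bullet> w)\<^sup>2)"
    by (simp add: q_def inner_simps inner_commute algebra_simps power2_eq_square)
  finally show ?thesis using \<open>v \<bullet> v > 0\<close> by (simp add: zero_less_mult_iff)
qed

text \<open>The law of cosines: this is \<open>2 * (u \<bullet> v)\<close> for vectors with \<open>norm u = a\<close>, \<open>norm v = b\<close> and
  \<open>norm (u - v) = c\<close>. This and the following definitions are polymorphic because the geometry needs
  them over the reals and the programs over the integers.\<close>

definition twice_dot :: "'a::comm_ring_1 \<Rightarrow> 'a \<Rightarrow> 'a \<Rightarrow> 'a" where
  "twice_dot a b c = a\<^sup>2 + b\<^sup>2 - c\<^sup>2"

text \<open>Heron's formula: 16 times the squared area of a triangle with sides \<open>a, b, c\<close>.\<close>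

definition heron :: "'a::comm_ring_1 \<Rightarrow> 'a \<Rightarrow> 'a \<Rightarrow> 'a" where
  "heron a b c = 4 * a\<^sup>2 * b\<^sup>2 - (twice_dot a b c)\<^sup>2"

text \<open>The value of \<open>4 * a\<^sup>2 * g\<^sup>2\<close> when the two triangles at the edge of length \<open>a\<close> lie in perpendicular
  planes: the squared distance of the feet of their altitudes, plus the squares of the altitudes,
  all scaled by \<open>(2 * a)\<^sup>2\<close>.\<close>

definition right_fold :: "'a::comm_ring_1 \<Rightarrow> 'a \<Rightarrow> 'a \<Rightarrow> 'a \<Rightarrow> 'a \<Rightarrow> 'a" where
  "right_fold a b c e f = (twice_dot a b c - twice_dot a e f)\<^sup>2 + heron a b c + heron a e f"

text \<open>The last condition says that the dihedral angle at the common edge has a cosine strictly between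
  \<open>-1\<close> and \<open>1\<close>, squared to avoid the roots of the two areas.\<close>

definition nondegenerate :: "'a::linordered_idom \<Rightarrow> 'a \<Rightarrow> 'a \<Rightarrow> 'a \<Rightarrow> 'a \<Rightarrow> 'a \<Rightarrow> bool" where
  "nondegenerate a b c e f g \<longleftrightarrow> heron a b c > 0 \<and> heron a e f > 0 \<and>
     (4 * a\<^sup>2 * g\<^sup>2 - right_fold a b c e f)\<^sup>2 < 4 * heron a b c * heron a e f"

lemma nondegenerate_of_int:
  "nondegenerate (of_int a) (of_int b) (of_int c) (of_int e) (of_int f) (of_int g :: real)
    \<longleftrightarrow> nondegenerate a b c e f g"
proof -
  have t: "twice_dot (of_int a) (of_int b) (of_int c) = (of_int (twice_dot a b c) :: real)" for a b c
    by (simp add: twice_dot_def)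
  have h: "heron (of_int a) (of_int b) (of_int c) = (of_int (heron a b c) :: real)" for a b c
    by (simp add: heron_def t)
  have r: "right_fold (of_int a) (of_int b) (of_int c) (of_int e) (of_int f)
      = (of_int (right_fold a b c e f) :: real)"
    by (simp add: right_fold_def t h)
  have "(4 * (of_int a)\<^sup>2 * (of_int g)\<^sup>2 - of_int N)\<^sup>2 < 4 * of_int H * (of_int K :: real) \<longleftrightarrow>
      of_int ((4 * a\<^sup>2 * g\<^sup>2 - N)\<^sup>2) < (of_int (4 * H * K) :: real)" for N H K
    by (simp only: of_int_power of_int_mult of_int_diff of_int_numeral)
  then show ?thesis
    unfolding nondegenerate_def h r by (simp only: of_int_less_iff of_int_0_less_iff)
qed

text \<open>All three conditions are instances of the strict Cauchy-Schwarz inequality: for \<open>u, v\<close>, for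
  \<open>u, w\<close>, and for the components of \<open>v\<close> and \<open>w\<close> orthogonal to \<open>u\<close>, whose angle is the dihedral
  angle.\<close>

lemma nondegenerate_of_independent:
  fixes u v w :: "'a::real_inner"
  assumes indep: "\<And>x y z. x *\<^sub>R u + y *\<^sub>R v + z *\<^sub>R w = 0 \<Longrightarrow> x = 0 \<and> y = 0 \<and> z = 0"
  shows "nondegenerate (norm u) (norm v) (norm (u - v)) (norm w) (norm (u - w)) (norm (v - w))"
proof -
  define A where "A = u \<bullet> u"
  define p where "p = u \<bullet> v"
  define q where "q = u \<bullet> w"
  have "A > 0" using indep[of 1 0 0] by (auto simp: A_def)
  have n: "(norm x)\<^sup>2 = x \<bullet> x" for x :: 'a by (simp add: power2_norm_eq_inner)
  have X: "twice_dot (norm u) (norm v) (norm (u - v)) = 2 * p" 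
    by (simp add: twice_dot_def n p_def inner_simps inner_commute)
  have W: "twice_dot (norm u) (norm w) (norm (u - w)) = 2 * q" 
    by (simp add: twice_dot_def n q_def inner_simps inner_commute)
  have Y: "heron (norm u) (norm v) (norm (u - v)) = 4 * (A * (v \<bullet> v) - p\<^sup>2)"
    by (simp add: heron_def X n A_def power_mult_distrib)
  have Z: "heron (norm u) (norm w) (norm (u - w)) = 4 * (A * (w \<bullet> w) - q\<^sup>2)"
    by (simp add: heron_def W n A_def power_mult_distrib)
  have p: "p\<^sup>2 < A * (v \<bullet> v)"
    unfolding p_def A_def using indep[of _ _ 0] by (intro strict_Cauchy_Schwarz) auto
  have q: "q\<^sup>2 < A * (w \<bullet> w)"
    unfolding q_def A_def using indep[of _ 0] by (intro strict_Cauchy_Schwarz) auto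
  \<comment> \<open>the orthogonal components, scaled by \<open>A = u \<bullet> u\<close> to avoid division\<close>
  define v' w' where vw: "v' = A *\<^sub>R v - p *\<^sub>R u" "w' = A *\<^sub>R w - q *\<^sub>R u"
  have "(v' \<bullet> w')\<^sup>2 < (v' \<bullet> v') * (w' \<bullet> w')"
  proof (rule strict_Cauchy_Schwarz)
    fix x y assume "x *\<^sub>R v' + y *\<^sub>R w' = 0"
    then have "(- (x * p) - y * q) *\<^sub>R u + (x * A) *\<^sub>R v + (y * A) *\<^sub>R w = 0"
      by (simp add: vw algebra_simps)
    from indep[OF this] show "x = 0 \<and> y = 0" using \<open>A > 0\<close> by auto
  qed
  also have "v' \<bullet> w' = A * (A * (v \<bullet> w) - p * q)"
    by (simp add: vw inner_simps inner_commute A_def p_def q_def algebra_simps)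
  also have "v' \<bullet> v' = A * (A * (v \<bullet> v) - p\<^sup>2)"
    by (simp add: vw inner_simps inner_commute A_def p_def q_def algebra_simps power2_eq_square)
  also have "w' \<bullet> w' = A * (A * (w \<bullet> w) - q\<^sup>2)"
    by (simp add: vw inner_simps inner_commute A_def p_def q_def algebra_simps power2_eq_square)
  finally have "A\<^sup>2 * (A * (v \<bullet> w) - p * q)\<^sup>2 < A\<^sup>2 * ((A * (v \<bullet> v) - p\<^sup>2) * (A * (w \<bullet> w) - q\<^sup>2))"
    by (simp add: power2_eq_square algebra_simps)
  then have "(A * (v \<bullet> w) - p * q)\<^sup>2 < (A * (v \<bullet> v) - p\<^sup>2) * (A * (w \<bullet> w) - q\<^sup>2)"
    using \<open>A > 0\<close> by simp
  moreover have "4 * (norm u)\<^sup>2 * (norm (v - w))\<^sup>2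
      - right_fold (norm u) (norm v) (norm (u - v)) (norm w) (norm (u - w))
      = - 8 * (A * (v \<bullet> w) - p * q)"
    unfolding right_fold_def X W Y Z n
    by (simp add: A_def[symmetric] inner_simps inner_commute algebra_simps power2_eq_square)
  moreover have "0 < 4 * P \<and> 0 < 4 * Q \<and> (- 8 * t)\<^sup>2 < 4 * (4 * P) * (4 * Q)"
    if "0 < P" "0 < Q" "t\<^sup>2 < P * Q" for P Q t :: real
    using that by (simp add: power_mult_distrib)
  ultimately show ?thesis
    using p q by (simp add: nondegenerate_def Y Z del: right_diff_distrib_numeral)
qed

lemma norm_vector_3: "norm (vector [x, y, z] :: real ^ 3) = sqrt (x\<^sup>2 + y\<^sup>2 + z\<^sup>2)"
  by (simp add: norm_eq_sqrt_inner inner_vec_def sum_3 power2_eq_square)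

lemma vector_3_diff:
  "vector [x, y, z] - vector [x', y', z'] = (vector [x - x', y - y', z - z'] :: real ^ 3)"
  by (simp add: vec_eq_iff forall_3)

text \<open>Lay the hinge along the first axis and one triangle into the plane of the first two axes, and
  rotate the other triangle by the prescribed dihedral angle.\<close>

lemma points_of_nondegenerate:
  fixes a b c e f g :: real
  assumes pos: "a > 0" "b > 0" "c > 0" "e > 0" "f > 0" "g > 0"
    and nd: "nondegenerate a b c e f g"
  obtains u v w :: "real ^ 3" where
    "norm u = a" "norm v = b" "norm (u - v) = c" "norm w = e" "norm (u - w) = f" "norm (v - w) = g"
    "\<And>x y z. x *\<^sub>R u + y *\<^sub>R v + z *\<^sub>R w = 0 \<Longrightarrow> x = 0 \<and> y = 0 \<and> z = 0"
proof -
  define X W Y Z N where defs: "X = twice_dot a b c" "W = twice_dot a e f"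
    "Y = sqrt (heron a b c)" "Z = sqrt (heron a e f)" "N = right_fold a b c e f"
  have YZ: "Y > 0" "Z > 0" and Y2: "Y\<^sup>2 = 4 * a\<^sup>2 * b\<^sup>2 - X\<^sup>2" and Z2: "Z\<^sup>2 = 4 * a\<^sup>2 * e\<^sup>2 - W\<^sup>2"
    and h: "heron a b c = Y\<^sup>2" "heron a e f = Z\<^sup>2"
    and N: "N = (X - W)\<^sup>2 + Y\<^sup>2 + Z\<^sup>2"
    using nd by (auto simp: nondegenerate_def defs heron_def right_fold_def)
  \<comment> \<open>\<open>k\<close> and \<open>s\<close> are the cosine and the sine of the dihedral angle\<close>
  define k where "k = (N - 4 * a\<^sup>2 * g\<^sup>2) / (2 * Y * Z)"
  have "(N - 4 * a\<^sup>2 * g\<^sup>2)\<^sup>2 < (2 * Y * Z)\<^sup>2"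
    using nd by (simp add: nondegenerate_def h defs(5)[symmetric] power_mult_distrib power2_commute)
  then have "k\<^sup>2 < 1"
    using YZ by (simp add: k_def power_divide divide_simps)
  define s where "s = sqrt (1 - k\<^sup>2)"
  have s: "s > 0" "s\<^sup>2 = 1 - k\<^sup>2" using \<open>k\<^sup>2 < 1\<close> by (auto simp: s_def)
  have kYZ: "2 * Y * Z * k = N - 4 * a\<^sup>2 * g\<^sup>2" using YZ by (simp add: k_def)
  define u v w :: "real ^ 3" where uvw: "u = vector [a, 0, 0]"
    "v = vector [X / (2 * a), Y / (2 * a), 0]"
    "w = vector [W / (2 * a), Z * k / (2 * a), Z * s / (2 * a)]"
  have norm: "norm (vector [x / (2 * a), y / (2 * a), z / (2 * a)] :: real ^ 3) = m"
    if "x\<^sup>2 + y\<^sup>2 + z\<^sup>2 = 4 * a\<^sup>2 * m\<^sup>2" "m > 0" for x y z m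
  proof -
    have "(x / (2 * a))\<^sup>2 + (y / (2 * a))\<^sup>2 + (z / (2 * a))\<^sup>2 = (x\<^sup>2 + y\<^sup>2 + z\<^sup>2) / (2 * a)\<^sup>2"
      by (simp add: power_divide add_divide_distrib)
    also have "\<dots> = m\<^sup>2" using \<open>a > 0\<close> that(1) by (simp add: power_mult_distrib)
    finally show ?thesis using \<open>m > 0\<close> by (simp add: norm_vector_3)
  qed
  have X: "X = a\<^sup>2 + b\<^sup>2 - c\<^sup>2" and W: "W = a\<^sup>2 + e\<^sup>2 - f\<^sup>2"
    by (simp_all add: defs twice_dot_def)
  have a: "a - t / (2 * a) = (2 * a\<^sup>2 - t) / (2 * a)" for t
    using pos by (simp add: power2_eq_square field_simps)
  have ks: "Z\<^sup>2 * k\<^sup>2 + Z\<^sup>2 * s\<^sup>2 = Z\<^sup>2" unfolding s(2) by (simp add: algebra_simps)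
  show thesis
  proof (rule that[of u v w])
    show "norm u = a" using pos by (simp add: uvw norm_vector_3)
    show "norm v = b"
      using norm[of X Y 0 b] pos by (simp add: uvw Y2)
    have "norm (vector [(2 * a\<^sup>2 - X) / (2 * a), - Y / (2 * a), 0 / (2 * a)] :: real ^ 3) = c"
      by (rule norm) (simp_all add: Y2 pos, simp add: X power2_eq_square algebra_simps)
    then show "norm (u - v) = c"
      by (simp add: uvw vector_3_diff a)
    have "norm (vector [W / (2 * a), Z * k / (2 * a), Z * s / (2 * a)] :: real ^ 3) = e"
      by (rule norm) (use ks Z2 pos in \<open>simp_all add: power_mult_distrib\<close>)
    then show "norm w = e" by (simp add: uvw)
    have "norm (vector [(2 * a\<^sup>2 - W) / (2 * a), - (Z * k) / (2 * a), - (Z * s) / (2 * a)] :: real ^ 3) = f"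
    proof (rule norm)
      have "(2 * a\<^sup>2 - W)\<^sup>2 + (4 * a\<^sup>2 * e\<^sup>2 - W\<^sup>2) = 4 * a\<^sup>2 * f\<^sup>2"
        by (simp add: W power2_eq_square algebra_simps)
      then show "(2 * a\<^sup>2 - W)\<^sup>2 + (- (Z * k))\<^sup>2 + (- (Z * s))\<^sup>2 = 4 * a\<^sup>2 * f\<^sup>2"
        using ks Z2 by (simp add: power_mult_distrib)
    qed (use pos in simp)
    then show "norm (u - w) = f"
      by (simp add: uvw vector_3_diff a)
    have "norm (vector [(X - W) / (2 * a), (Y - Z * k) / (2 * a), - (Z * s) / (2 * a)] :: real ^ 3) = g"
    proof (rule norm)
      have "(X - W)\<^sup>2 + (Y - Z * k)\<^sup>2 + (- (Z * s))\<^sup>2 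
          = (X - W)\<^sup>2 + Y\<^sup>2 - 2 * Y * Z * k + (Z\<^sup>2 * k\<^sup>2 + Z\<^sup>2 * s\<^sup>2)"
        by (simp add: power2_diff power_mult_distrib)
      then show "(X - W)\<^sup>2 + (Y - Z * k)\<^sup>2 + (- (Z * s))\<^sup>2 = 4 * a\<^sup>2 * g\<^sup>2"
        unfolding ks kYZ N by simp
    qed (use pos in simp)
    then show "norm (v - w) = g"
      by (simp add: uvw vector_3_diff diff_divide_distrib)
    fix x y z
    assume "x *\<^sub>R u + y *\<^sub>R v + z *\<^sub>R w = 0"
    then have "x * a + y * X / (2 * a) + z * W / (2 * a) = 0"
      "y * Y / (2 * a) + z * (Z * k) / (2 * a) = 0" "z = 0"
      using YZ pos s by (auto simp: uvw vec_eq_iff forall_3)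
    then show "x = 0 \<and> y = 0 \<and> z = 0"
      using YZ pos by simp
  qed
qed

lemma integral_tetrahedron_iff:
  "integral_tetrahedron (a, b, c, e, f, g) \<longleftrightarrow>
     a > 0 \<and> b > 0 \<and> c > 0 \<and> e > 0 \<and> f > 0 \<and> g > 0 \<and> nondegenerate a b c e f g"
    (is "?T \<longleftrightarrow> ?N")
proof -
  have pos: "(\<forall>i<4. \<forall>j<4. i \<noteq> j \<longrightarrow> side (a, b, c, e, f, g) i j > 0) \<longleftrightarrow>
      a > 0 \<and> b > 0 \<and> c > 0 \<and> e > 0 \<and> f > 0 \<and> g > 0"
    unfolding all_less_4 by (auto simp: doubleton_eq_iff)
  have norms: "(\<forall>i<4. \<forall>j<4. i \<noteq> j \<longrightarrow> norm (p i - p j) = of_int (side (a, b, c, e, f, g) i j)) \<longleftrightarrow>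
      norm (p 1 - p 0) = of_int a \<and> norm (p 2 - p 0) = of_int b \<and>
      norm ((p 1 - p 0) - (p 2 - p 0)) = of_int c \<and> norm (p 3 - p 0) = of_int e \<and>
      norm ((p 1 - p 0) - (p 3 - p 0)) = of_int f \<and> norm ((p 2 - p 0) - (p 3 - p 0)) = of_int g"
    for p :: "nat \<Rightarrow> real ^ 3"
  proof -
    have "(p 1 - p 0) - (p 2 - p 0) = p 1 - p 2" "(p 1 - p 0) - (p 3 - p 0) = p 1 - p 3"
      "(p 2 - p 0) - (p 3 - p 0) = p 2 - p 3" by simp_all
    note this and norm_minus_commute[of "p 0" "p 1"] norm_minus_commute[of "p 0" "p 2"]
      norm_minus_commute[of "p 0" "p 3"] norm_minus_commute[of "p 2" "p 1"]
      norm_minus_commute[of "p 3" "p 1"] norm_minus_commute[of "p 3" "p 2"]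
    note eqs = this
    show ?thesis
      unfolding all_less_4 eqs by (simp add: doubleton_eq_iff del: One_nat_def) blast
  qed
  show ?thesis
  proof
    assume T: ?T
    obtain p :: "nat \<Rightarrow> real ^ 3" where p: "inj_on p {..<4} \<and> \<not> affine_dependent (p ` {..<4}) \<and>
        (\<forall>i<4. \<forall>j<4. i \<noteq> j \<longrightarrow> norm (p i - p j) = of_int (side (a, b, c, e, f, g) i j))"
      by (rule exE[OF conjunct2[OF T[unfolded integral_tetrahedron_def]]])
    have inj: "inj_on p {..<4}" and indep: "\<not> affine_dependent (p ` {..<4})"
      and n: "\<forall>i<4. \<forall>j<4. i \<noteq> j \<longrightarrow> norm (p i - p j) = of_int (side (a, b, c, e, f, g) i j)"
      by (rule conjunct1[OF p] conjunct1[OF conjunct2[OF p]] conjunct2[OF conjunct2[OF p]])+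
    have s: "\<forall>i<4. \<forall>j<4. i \<noteq> j \<longrightarrow> side (a, b, c, e, f, g) i j > 0"
      by (rule conjunct1[OF T[unfolded integral_tetrahedron_def]])
    have "nondegenerate (norm (p 1 - p 0)) (norm (p 2 - p 0)) (norm ((p 1 - p 0) - (p 2 - p 0)))
        (norm (p 3 - p 0)) (norm ((p 1 - p 0) - (p 3 - p 0))) (norm ((p 2 - p 0) - (p 3 - p 0)))"
      using indep unfolding affine_dependent_4[OF inj]
      by (intro nondegenerate_of_independent) blast
    then have "nondegenerate (of_int a) (of_int b) (of_int c) (of_int e) (of_int f) (of_int g :: real)"
      using n unfolding norms by simp
    then show ?N
      using s unfolding pos nondegenerate_of_int by blast
  next
    assume N: ?N
    then obtain u v w :: "real ^ 3" where uvw: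
      "norm u = of_int a" "norm v = of_int b" "norm (u - v) = of_int c"
      "norm w = of_int e" "norm (u - w) = of_int f" "norm (v - w) = of_int g"
      "\<And>x y z. x *\<^sub>R u + y *\<^sub>R v + z *\<^sub>R w = 0 \<Longrightarrow> x = 0 \<and> y = 0 \<and> z = 0"
      using points_of_nondegenerate[of "of_int a" "of_int b" "of_int c" "of_int e" "of_int f" "of_int g"]
      unfolding nondegenerate_of_int by auto
    define p where "p i = [0, u, v, w] ! i" for i
    have p: "p 0 = 0" "p 1 = u" "p 2 = v" "p 3 = w" by (simp_all add: p_def)
    have n: "\<forall>i<4. \<forall>j<4. i \<noteq> j \<longrightarrow> norm (p i - p j) = of_int (side (a, b, c, e, f, g) i j)"
      unfolding norms p using uvw by simp
    have s: "\<forall>i<4. \<forall>j<4. i \<noteq> j \<longrightarrow> side (a, b, c, e, f, g) i j > 0"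
      using N unfolding pos by blast
    have inj: "inj_on p {..<4}"
    proof (rule inj_onI, rule ccontr)
      fix i j assume ij: "i \<in> {..<4}" "j \<in> {..<4}" "p i = p j" "i \<noteq> j"
      then have "norm (p i - p j) = of_int (side (a, b, c, e, f, g) i j)"
        "side (a, b, c, e, f, g) i j > 0"
        using n s by blast+
      with ij(3) show False by simp
    qed
    have "\<not> affine_dependent (p ` {..<4})"
      unfolding affine_dependent_4[OF inj] p using uvw(7) by auto
    with inj n s show ?T
      unfolding integral_tetrahedron_def by (intro conjI exI[of _ p])
  qed
qed

section \<open>The interval for the last side\<close>

lemma le_floor_sqrt_iff:
  fixes g x :: int
  assumes "0 \<le> g"
  shows "g \<le> \<lfloor>sqrt (real_of_int x)\<rfloor> \<longleftrightarrow> g\<^sup>2 \<le> x"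
proof -
  have "real_of_int g = sqrt (real_of_int (g\<^sup>2))" using assms by simp
  then have "g \<le> \<lfloor>sqrt (real_of_int x)\<rfloor> \<longleftrightarrow> sqrt (real_of_int (g\<^sup>2)) \<le> sqrt (real_of_int x)"
    unfolding le_floor_iff by (simp only:)
  then show ?thesis by (simp only: real_sqrt_le_iff of_int_le_iff)
qed

lemma le_div_iff_mult_le:
  fixes k m n :: int
  assumes "0 < k"
  shows "m \<le> n div k \<longleftrightarrow> k * m \<le> n"
proof
  assume "m \<le> n div k"
  then have "k * m \<le> k * (n div k)" using assms by simp
  also have "\<dots> \<le> n" using assms by (simp add: minus_mod_eq_mult_div [symmetric])
  finally show "k * m \<le> n" .
next
  assume "k * m \<le> n"
  then have "(k * m) div k \<le> n div k" using assms by (rule zdiv_mono1)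
  then show "m \<le> n div k" using assms by simp
qed

text \<open>The bound for \<open>\<bar>4 * a\<^sup>2 * g\<^sup>2 - right_fold a b c e f\<bar>\<close>. Subtracting \<open>1\<close> under the root
  accounts for the strict inequality in \<open>nondegenerate\<close>, see \<open>le_fold_radius_iff\<close>.\<close>

definition fold_radius :: "int \<Rightarrow> int \<Rightarrow> int \<Rightarrow> int \<Rightarrow> int \<Rightarrow> int" where
  "fold_radius a b c e f = \<lfloor>sqrt (real_of_int (4 * heron a b c * heron a e f - 1))\<rfloor>"

text \<open>One more than the largest \<open>g\<close> for which \<open>4 * a\<^sup>2 * g\<^sup>2\<close> is still too small, that is, below
  \<open>right_fold a b c e f - fold_radius a b c e f\<close>.\<close>

definition min_side :: "int \<Rightarrow> int \<Rightarrow> int \<Rightarrow> int \<Rightarrow> int \<Rightarrow> int" where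
  "min_side a b c e f =
     \<lfloor>sqrt (real_of_int ((right_fold a b c e f - fold_radius a b c e f - 1) div (4 * a\<^sup>2)))\<rfloor> + 1"

definition max_side :: "int \<Rightarrow> int \<Rightarrow> int \<Rightarrow> int \<Rightarrow> int \<Rightarrow> int" where
  "max_side a b c e f =
     \<lfloor>sqrt (real_of_int ((right_fold a b c e f + fold_radius a b c e f) div (4 * a\<^sup>2)))\<rfloor>"

lemma le_fold_radius_iff:
  assumes "0 \<le> x"
  shows "x \<le> fold_radius a b c e f \<longleftrightarrow> x\<^sup>2 < 4 * heron a b c * heron a e f"
  unfolding fold_radius_def using assms by (simp only: le_floor_sqrt_iff zle_diff1_eq)

text \<open>With \<open>Y = heron a b c\<close> and \<open>Z = heron a e f\<close>, the square of \<open>fold_radius\<close> is less than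
  \<open>4 * Y * Z \<le> (Y + Z)\<^sup>2\<close>, and \<open>Y + Z \<le> right_fold a b c e f\<close>. So the interval
  contains positive numbers only, without a separate test.\<close>

lemma min_side_pos:
  assumes a: "a > 0" and Y: "heron a b c > 0" and Z: "heron a e f > 0"
  shows "min_side a b c e f > 0"
proof -
  define N R where "N = right_fold a b c e f" and "R = fold_radius a b c e f"
  have "0 \<le> R" using le_fold_radius_iff[of 0] Y Z by (simp add: R_def)
  have "R < N"
  proof (rule power_less_imp_less_base)
    have "R\<^sup>2 < 4 * heron a b c * heron a e f"
      using le_fold_radius_iff[of R a b c e f] \<open>0 \<le> R\<close> by (simp add: R_def)
    also have "\<dots> \<le> (heron a b c + heron a e f)\<^sup>2"
      using zero_le_power2[of "heron a b c - heron a e f"]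
      by (simp add: power2_eq_square algebra_simps)
    also have "\<dots> \<le> N\<^sup>2"
      using Y Z by (intro power_mono) (simp_all add: N_def right_fold_def)
    finally show "R\<^sup>2 < N\<^sup>2" .
    show "0 \<le> N" using Y Z by (simp add: N_def right_fold_def)
  qed
  then have "0 \<le> (N - R - 1) div (4 * a\<^sup>2)"
    using a by (simp add: le_div_iff_mult_le)
  then show ?thesis
    unfolding min_side_def N_def[symmetric] R_def[symmetric] by simp
qed

lemma nondegenerate_interval:
  assumes a: "a > 0" and Y: "heron a b c > 0" and Z: "heron a e f > 0" and g: "g > 0"
  shows "nondegenerate a b c e f g \<longleftrightarrow> min_side a b c e f \<le> g \<and> g \<le> max_side a b c e f"
proof -
  define N R where "N = right_fold a b c e f" and "R = fold_radius a b c e f"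
  have a2: "4 * a\<^sup>2 > 0" using a by simp
  have "min_side a b c e f \<le> g \<longleftrightarrow> \<not> g \<le> \<lfloor>sqrt (real_of_int ((N - R - 1) div (4 * a\<^sup>2)))\<rfloor>"
    unfolding min_side_def N_def R_def by linarith
  also have "\<dots> \<longleftrightarrow> \<not> 4 * a\<^sup>2 * g\<^sup>2 \<le> N - R - 1"
    using g by (simp only: le_floor_sqrt_iff le_div_iff_mult_le[OF a2] less_imp_le)
  finally have 1: "min_side a b c e f \<le> g \<longleftrightarrow> N - R \<le> 4 * a\<^sup>2 * g\<^sup>2" by linarith
  have 2: "g \<le> max_side a b c e f \<longleftrightarrow> 4 * a\<^sup>2 * g\<^sup>2 \<le> N + R"
    unfolding max_side_def N_def[symmetric] R_def[symmetric]
    using g by (simp only: le_floor_sqrt_iff le_div_iff_mult_le[OF a2] less_imp_le)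
  have "nondegenerate a b c e f g \<longleftrightarrow> \<bar>4 * a\<^sup>2 * g\<^sup>2 - N\<bar>\<^sup>2 < 4 * heron a b c * heron a e f"
    using Y Z by (simp add: nondegenerate_def N_def)
  also have "\<dots> \<longleftrightarrow> \<bar>4 * a\<^sup>2 * g\<^sup>2 - N\<bar> \<le> R"
    unfolding R_def by (rule le_fold_radius_iff[symmetric]) simp
  finally show ?thesis unfolding 1 2 by linarith
qed

text \<open>Every edge can be moved to the first place of the tuple, where it has to compete with \<open>a\<close>.\<close>

lemma canonical_side_le:
  assumes can: "canonical (a, b, c, e, f, g)" and ij: "i < 4" "j < 4" "i \<noteq> j"
  shows "side (a, b, c, e, f, g) i j \<le> a"
proof -
  have "card ({..<4} - {i, j}) = 2" using ij by simp
  then obtain k l where kl: "{..<4} - {i, j} = {k, l}" "k \<noteq> l" by (auto simp: card_2_iff)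
  then have "k \<in> {..<4} - {i, j}" "l \<in> {..<4} - {i, j}" by simp_all
  then have "(i, j, k, l) \<in> set labellings"
    using kl(2) ij unfolding set_labellings by simp
  with can[unfolded canonical_labellings] have "ord_class.lexordp_eq
      [side (a, b, c, e, f, g) i j, side (a, b, c, e, f, g) i k, side (a, b, c, e, f, g) j k,
       side (a, b, c, e, f, g) i l, side (a, b, c, e, f, g) j l, side (a, b, c, e, f, g) k l]
      (to_list (a, b, c, e, f, g))"
    by (blast dest: bspec)
  then show ?thesis by (auto simp del: side.simps)
qed

lemma canonical_diameter:
  assumes "canonical (a, b, c, e, f, g)"
  shows "tetra_diameter (a, b, c, e, f, g) = a"
proof (rule antisym)
  show "tetra_diameter (a, b, c, e, f, g) \<le> a"
    unfolding tetra_diameter_le_iff using canonical_side_le[OF assms] by (intro allI impI)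
  have "side (a, b, c, e, f, g) 0 1 \<le> tetra_diameter (a, b, c, e, f, g)"
    by (rule side_le_tetra_diameter) simp_all
  then show "a \<le> tetra_diameter (a, b, c, e, f, g)" by simp
qed

text \<open>For every \<open>g\<close>, the least candidate that is not below \<open>g\<close> is separated from \<open>g\<close> by none of the
  five sides in the sense of \<open>canonical_move\<close>; this is why each side \<open>z\<close> comes with \<open>z - 1\<close>.\<close>

definition bound_candidates :: "int \<Rightarrow> int \<Rightarrow> int \<Rightarrow> int \<Rightarrow> int \<Rightarrow> int set" where
  "bound_candidates a b c e f =
     {max_side a b c e f, a, b, c, e, f, a - 1, b - 1, c - 1, e - 1, f - 1}"

text \<open>The default value \<open>0\<close> makes the printed interval empty, as its lower end \<open>min_side\<close> is positive.\<close>

definition upper_bound :: "int \<Rightarrow> int \<Rightarrow> int \<Rightarrow> int \<Rightarrow> int \<Rightarrow> int" where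
  "upper_bound a b c e f = Max (insert 0 {v \<in> bound_candidates a b c e f.
     v \<le> max_side a b c e f \<and> canonical (a, b, c, e, f, v)})"

lemma canonical_interval:
  assumes "g > 0"
  shows "g \<le> upper_bound a b c e f \<longleftrightarrow> g \<le> max_side a b c e f \<and> canonical (a, b, c, e, f, g)"
proof -
  let ?C = "bound_candidates a b c e f" and ?m = "max_side a b c e f"
  let ?S = "{v \<in> ?C. v \<le> ?m \<and> canonical (a, b, c, e, f, v)}"
  have fin: "finite ?C" by (simp add: bound_candidates_def)
  show ?thesis
  proof
    assume le: "g \<le> upper_bound a b c e f"
    have "upper_bound a b c e f \<in> insert 0 ?S"
      unfolding upper_bound_def using fin by (intro Max_in) auto
    then have u: "upper_bound a b c e f \<le> ?m" "canonical (a, b, c, e, f, upper_bound a b c e f)"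
      using le assms by auto
    then have "canonical (a, b, c, e, f, g)"
      by (elim canonical_move) (use le in auto)
    then show "g \<le> ?m \<and> canonical (a, b, c, e, f, g)" using le u(1) by simp
  next
    assume g: "g \<le> ?m \<and> canonical (a, b, c, e, f, g)"
    \<comment> \<open>raise \<open>g\<close> to the next candidate; it stays canonical and feasible\<close>
    define v where "v = Min {w \<in> ?C. g \<le> w}"
    have "?m \<in> {w \<in> ?C. g \<le> w}" using g by (simp add: bound_candidates_def)
    then have v: "v \<in> {w \<in> ?C. g \<le> w}" unfolding v_def using fin by (intro Min_in) auto
    have least: "v \<le> w" if "w \<in> ?C" "g \<le> w" for w
      unfolding v_def using that fin by (intro Min_le) auto
    have "canonical (a, b, c, e, f, v)"
    proof (rule canonical_move)
      show "canonical (a, b, c, e, f, g)" using g by simp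
      show "\<forall>z\<in>{a, b, c, e, f}. (g < z \<longrightarrow> v < z) \<and> (g = z \<longrightarrow> v \<le> z)"
      proof (intro ballI conjI impI)
        fix z assume z: "z \<in> {a, b, c, e, f}"
        then have C: "z \<in> ?C" "z - 1 \<in> ?C" by (auto simp: bound_candidates_def)
        show "v < z" if "g < z" using least[OF C(2)] that by simp
        show "v \<le> z" if "g = z" using least[OF C(1)] that by simp
      qed
    qed
    moreover have "v \<le> ?m" using g by (intro least) (simp_all add: bound_candidates_def)
    ultimately have "v \<le> upper_bound a b c e f"
      unfolding upper_bound_def using v fin by (intro Max_ge) auto
    then show "g \<le> upper_bound a b c e f" using v by simp
  qed
qed

definition entries :: "int \<Rightarrow> int \<Rightarrow> int \<Rightarrow> int \<Rightarrow> int \<Rightarrow> entry list" where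
  "entries a b c e f = (if heron a b c > 0 \<and> heron a e f > 0
     then [((a, b, c, e, f), min_side a b c e f, upper_bound a b c e f)] else [])"

lemma represented_entries:
  assumes pos: "a > 0" "b > 0" "c > 0" "e > 0" "f > 0"
  shows "(\<Union>x\<in>set (entries a b c e f). represented x) =
    {(a, b, c, e, f, g) | g. integral_tetrahedron (a, b, c, e, f, g) \<and> canonical (a, b, c, e, f, g)}"
proof (cases "heron a b c > 0 \<and> heron a e f > 0")
  case True
  have "min_side a b c e f \<le> g \<and> g \<le> upper_bound a b c e f \<longleftrightarrow>
      integral_tetrahedron (a, b, c, e, f, g) \<and> canonical (a, b, c, e, f, g)" for g
  proof (cases "g > 0")
    case g: True
    then show ?thesis
      using nondegenerate_interval[of a b c e f g] canonical_interval[of g a b c e f] True pos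
      unfolding integral_tetrahedron_iff by auto
  next
    case False
    have "min_side a b c e f > 0" using True pos by (intro min_side_pos) auto
    then show ?thesis using False unfolding integral_tetrahedron_iff by auto
  qed
  then show ?thesis unfolding entries_def using True by auto
next
  case False
  then have "\<not> integral_tetrahedron (a, b, c, e, f, g)" for g
    unfolding integral_tetrahedron_iff nondegenerate_def by auto
  then show ?thesis unfolding entries_def using False by auto
qed

section \<open>The complete lists\<close>

definition entries_with_diameter :: "int \<Rightarrow> entry list" where
  "entries_with_diameter a = concat (map (\<lambda>b. concat (map (\<lambda>c. concat (map (\<lambda>e. concat (map (\<lambda>f.
     entries a b c e f) [1..a])) [1..a])) [1..a])) [1..a])"

lemma set_entries_with_diameter:
  "set (entries_with_diameter a) =
     (\<Union>b\<in>{1..a}. \<Union>c\<in>{1..a}. \<Union>e\<in>{1..a}. \<Union>f\<in>{1..a}. set (entries a b c e f))"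
  by (simp add: entries_with_diameter_def)

lemma represented_entries_with_diameter:
  "(\<Union>x\<in>set (entries_with_diameter a). represented x) =
     {\<delta>. integral_tetrahedron \<delta> \<and> canonical \<delta> \<and> tetra_diameter \<delta> = a}" (is "?L = ?R")
proof -
  have "?L = (\<Union>b\<in>{1..a}. \<Union>c\<in>{1..a}. \<Union>e\<in>{1..a}. \<Union>f\<in>{1..a}.
      \<Union>x\<in>set (entries a b c e f). represented x)"
    unfolding set_entries_with_diameter by (simp only: UN_UN_flatten UN_simps)
  also have "\<dots> = (\<Union>b\<in>{1..a}. \<Union>c\<in>{1..a}. \<Union>e\<in>{1..a}. \<Union>f\<in>{1..a}.
      {(a, b, c, e, f, g) | g. integral_tetrahedron (a, b, c, e, f, g) \<and> canonical (a, b, c, e, f, g)})"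
    by (intro SUP_cong refl represented_entries) auto
  also have "\<dots> = ?R"
  proof (intro equalityI subsetI)
    fix \<delta> assume "\<delta> \<in> (\<Union>b\<in>{1..a}. \<Union>c\<in>{1..a}. \<Union>e\<in>{1..a}. \<Union>f\<in>{1..a}.
      {(a, b, c, e, f, g) | g. integral_tetrahedron (a, b, c, e, f, g) \<and> canonical (a, b, c, e, f, g)})"
    then show "\<delta> \<in> ?R" by (auto simp: canonical_diameter)
  next
    fix \<delta> assume \<delta>: "\<delta> \<in> ?R"
    obtain a' b c e f g where eq: "\<delta> = (a', b, c, e, f, g)" by (cases \<delta>) auto
    have can: "canonical (a', b, c, e, f, g)" and T: "integral_tetrahedron (a', b, c, e, f, g)"
      and "a' = a"
      using \<delta> canonical_diameter unfolding eq by auto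
    have "side (a', b, c, e, f, g) 0 2 \<le> a'" "side (a', b, c, e, f, g) 1 2 \<le> a'"
      "side (a', b, c, e, f, g) 0 3 \<le> a'" "side (a', b, c, e, f, g) 1 3 \<le> a'"
      by (rule canonical_side_le[OF can]; simp)+
    then have "b \<in> {1..a}" "c \<in> {1..a}" "e \<in> {1..a}" "f \<in> {1..a}"
      using T \<open>a' = a\<close> by (auto simp: integral_tetrahedron_iff doubleton_eq_iff)
    then show "\<delta> \<in> (\<Union>b\<in>{1..a}. \<Union>c\<in>{1..a}. \<Union>e\<in>{1..a}. \<Union>f\<in>{1..a}.
      {(a, b, c, e, f, g) | g. integral_tetrahedron (a, b, c, e, f, g) \<and> canonical (a, b, c, e, f, g)})"
      using can T unfolding eq \<open>a' = a\<close> by blast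
  qed
  finally show ?thesis .
qed

lemma distinct_map_concat:
  assumes "distinct xs" and "\<And>x. x \<in> set xs \<Longrightarrow> distinct (map k (F x))"
    and "\<And>x y. x \<in> set xs \<Longrightarrow> y \<in> set (F x) \<Longrightarrow> h (k y) = x"
  shows "distinct (map k (concat (map F xs)))"
  using assms
proof (induction xs)
  case (Cons x xs)
  have "k ` set (F x) \<inter> k ` (\<Union>y\<in>set xs. set (F y)) = {}"
  proof (rule ccontr)
    assume "\<not> ?thesis"
    then obtain y u v where "y \<in> set xs" "u \<in> set (F x)" "v \<in> set (F y)" "k u = k v" by auto
    then have "x = y" using Cons.prems(3)[of x u] Cons.prems(3)[of y v] by simp
    then show False using Cons.prems(1) \<open>y \<in> set xs\<close> by simp
  qed
  then show ?case using Cons by simp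
qed simp

lemma fst_entries: "x \<in> set (entries a b c e f) \<Longrightarrow> fst x = (a, b, c, e, f)"
  by (auto simp: entries_def split: if_splits)

lemma distinct_entries_with_diameter: "distinct (map fst (entries_with_diameter a))"
proof -
  have "distinct (map fst (entries a b c e f))" for b c e f by (simp add: entries_def)
  \<comment> \<open>the loop variable of each level is a component of the printed 5-tuple\<close>
  note 1 = distinct_map_concat[where k = fst and h = "\<lambda>(a, b, c, e, f). f", OF distinct_upto this]
  have "distinct (map fst (concat (map (\<lambda>f. entries a b c e f) [1..a])))" for b c e
    by (rule 1) (auto dest: fst_entries)
  note 2 = distinct_map_concat[where k = fst and h = "\<lambda>(a, b, c, e, f). e", OF distinct_upto this]
  have "distinct (map fst (concat (map (\<lambda>e. concat (map (\<lambda>f. entries a b c e f) [1..a])) [1..a])))" for b c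
    by (rule 2) (auto dest: fst_entries)
  note 3 = distinct_map_concat[where k = fst and h = "\<lambda>(a, b, c, e, f). c", OF distinct_upto this]
  have "distinct (map fst (concat (map (\<lambda>c. concat (map (\<lambda>e. concat (map (\<lambda>f.
      entries a b c e f) [1..a])) [1..a])) [1..a])))" for b
    by (rule 3) (auto dest: fst_entries)
  note 4 = distinct_map_concat[where k = fst and h = "\<lambda>(a, b, c, e, f). b", OF distinct_upto this]
  show ?thesis
    unfolding entries_with_diameter_def by (rule 4) (auto dest: fst_entries)
qed

lemma list_of_diameter:
  "complete_implicit_list (entries_with_diameter a)
     {\<delta>. integral_tetrahedron \<delta> \<and> canonical \<delta> \<and> tetra_diameter \<delta> = a}"
  unfolding complete_implicit_list_def
  by (intro conjI distinct_entries_with_diameter represented_entries_with_diameter)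

lemma list_up_to_diameter:
  "complete_implicit_list (concat (map entries_with_diameter [1..d]))
     {\<delta>. integral_tetrahedron \<delta> \<and> canonical \<delta> \<and> tetra_diameter \<delta> \<le> d}" (is "complete_implicit_list ?L ?S")
  unfolding complete_implicit_list_def
proof
  show "distinct (map fst ?L)"
    by (rule distinct_map_concat[where h = "\<lambda>(a, b, c, e, f). a"])
      (auto simp: distinct_entries_with_diameter set_entries_with_diameter dest: fst_entries)
  have pos: "tetra_diameter \<delta> \<ge> 1" if "integral_tetrahedron \<delta>" for \<delta>
  proof -
    have "side \<delta> 0 1 > 0" using that by (simp add: integral_tetrahedron_def)
    moreover have "side \<delta> 0 1 \<le> tetra_diameter \<delta>"
      by (rule side_le_tetra_diameter) simp_all
    ultimately show ?thesis by simp
  qed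
  have "(\<Union>x\<in>set ?L. represented x) = (\<Union>a\<in>{1..d}. \<Union>x\<in>set (entries_with_diameter a). represented x)"
    by simp
  also have "\<dots> = ?S"
    unfolding represented_entries_with_diameter by (auto dest: pos)
  finally show "(\<Union>x\<in>set ?L. represented x) = ?S" .
qed

section \<open>Loops and their running time\<close>

text \<open>The set \<open>V\<close> contains the cells that the program may overwrite. It lets the body of a loop rely on
  the variables of the enclosing loops.\<close>

definition runs_within :: "com \<Rightarrow> store \<Rightarrow> nat \<Rightarrow> entry list \<Rightarrow> int set \<Rightarrow> bool" where
  "runs_within c s n L V \<longleftrightarrow> (\<exists>t s'. exec c s t L s' \<and> t \<le> n \<and> (\<forall>z. z \<notin> V \<longrightarrow> s' z = s z))"

definition for_loop :: "int \<Rightarrow> int \<Rightarrow> com \<Rightarrow> com" where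
  "for_loop x y c = Seq (Assign (Num x) (Num 1))
     (While (Leq (Cell (Num x)) (Cell (Num y)))
       (Seq c (Assign (Num x) (Plus (Cell (Num x)) (Num 1)))))"

text \<open>The constant 6 consists of 3 units for the loop test and 3 for the increment; the test that ends
  the loop costs another 3.\<close>

lemma while_runs_within:
  fixes s :: store
  assumes x: "x \<notin> V" "x \<noteq> y" "y \<notin> V"
    and body: "\<And>r. \<forall>z. z \<notin> insert x V \<longrightarrow> r z = s z \<Longrightarrow> 1 \<le> r x \<Longrightarrow> r x \<le> s y \<Longrightarrow>
      runs_within c r B (F (r x)) V"
    and r: "\<forall>z. z \<notin> insert x V \<longrightarrow> r z = s z" "1 \<le> r x" 
  shows "runs_within (While (Leq (Cell (Num x)) (Cell (Num y)))
      (Seq c (Assign (Num x) (Plus (Cell (Num x)) (Num 1))))) r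
      (nat (s y + 1 - r x) * (B + 6) + 3) (concat (map F [r x..s y])) (insert x V)"
    (is "runs_within ?W _ _ _ _")
  using r
proof (induction "nat (s y + 1 - r x)" arbitrary: r)
  case 0
  have "r y = s y" using 0 x by simp
  then have "exec ?W r (bcost (Leq (Cell (Num x)) (Cell (Num y)))) [] r"
    using 0 by (intro exec.WhileFalse) simp
  moreover have "[r x..s y] = []" using 0 by simp
  ultimately show ?case unfolding runs_within_def by fastforce
next
  case (Suc n)
  have ry: "r y = s y" using Suc.prems x by simp
  have le: "r x \<le> s y" using Suc.hyps(2) by linarith
  obtain t1 r1 where r1: "exec c r t1 (F (r x)) r1" "t1 \<le> B" "\<forall>z. z \<notin> V \<longrightarrow> r1 z = r z"
    using body[OF Suc.prems le] unfolding runs_within_def by blast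
  define r2 where "r2 = r1(x := r x + 1)"
  have "r1 x = r x" using r1(3) x by blast
  then have "exec (Assign (Num x) (Plus (Cell (Num x)) (Num 1))) r1 3 [] r2"
    using exec.Assign[of "Num x" "Plus (Cell (Num x)) (Num 1)" r1] by (simp add: r2_def numeral_3_eq_3)
  from exec.Seq[OF r1(1) this]
  have step: "exec (Seq c (Assign (Num x) (Plus (Cell (Num x)) (Num 1)))) r (t1 + 3) (F (r x)) r2"
    by simp
  have r2: "r2 x = r x + 1" "\<forall>z. z \<notin> insert x V \<longrightarrow> r2 z = r z"
    using r1(3) by (auto simp: r2_def)
  have "n = nat (s y + 1 - r2 x)" using Suc.hyps(2) r2(1) by linarith
  moreover have "\<forall>z. z \<notin> insert x V \<longrightarrow> r2 z = s z" using r2(2) Suc.prems(1) by simp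
  moreover have "1 \<le> r2 x" using r2(1) Suc.prems(2) by simp
  ultimately obtain t2 s' where s': "exec ?W r2 t2 (concat (map F [r2 x..s y])) s'"
    "t2 \<le> n * (B + 6) + 3" "\<forall>z. z \<notin> insert x V \<longrightarrow> s' z = r2 z"
    using Suc.hyps(1)[of r2] unfolding runs_within_def by metis
  have "exec ?W r (3 + (t1 + 3) + t2) (F (r x) @ concat (map F [r2 x..s y])) s'"
    using exec.WhileTrue[OF _ step s'(1)] le ry by simp
  moreover have "F (r x) @ concat (map F [r2 x..s y]) = concat (map F [r x..s y])"
    using upto_rec1[OF le] r2(1) by simp
  moreover have "3 + (t1 + 3) + t2 \<le> nat (s y + 1 - r x) * (B + 6) + 3"
    using r1(2) s'(2) unfolding Suc.hyps(2)[symmetric] by simp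
  ultimately show ?case
    using s'(3) r2(2) unfolding runs_within_def by (metis (no_types, lifting))
qed

text \<open>The overhead is \<open>6 * m + 4\<close>, which \<open>1 \<le> m\<close> allows to absorb into \<open>10 * m ^ Suc k\<close>. In this form
  the rule can be applied to nested loops, each of which raises the exponent by one.\<close>

lemma for_loop_runs_within:
  fixes s :: store
  assumes x: "x \<notin> V" "x \<noteq> y" "y \<notin> V"
    and m: "s y \<le> int m" "1 \<le> m"
    and body: "\<And>r. \<forall>z. z \<notin> insert x V \<longrightarrow> r z = s z \<Longrightarrow> 1 \<le> r x \<Longrightarrow> r x \<le> s y \<Longrightarrow>
      runs_within c r (B * m ^ k) (F (r x)) V"
  shows "runs_within (for_loop x y c) s ((B + 10) * m ^ Suc k) (concat (map F [1..s y])) (insert x V)"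
proof -
  define r where "r = s(x := 1)"
  have "runs_within (While (Leq (Cell (Num x)) (Cell (Num y)))
      (Seq c (Assign (Num x) (Plus (Cell (Num x)) (Num 1))))) r
      (nat (s y + 1 - r x) * (B * m ^ k + 6) + 3) (concat (map F [r x..s y])) (insert x V)"
    by (rule while_runs_within[OF x body]) (auto simp: r_def)
  then obtain t s' where s': "exec (While (Leq (Cell (Num x)) (Cell (Num y)))
      (Seq c (Assign (Num x) (Plus (Cell (Num x)) (Num 1))))) r t (concat (map F [1..s y])) s'"
    "t \<le> nat (s y) * (B * m ^ k + 6) + 3" "\<forall>z. z \<notin> insert x V \<longrightarrow> s' z = r z"
    unfolding runs_within_def r_def by auto
  have "exec (Assign (Num x) (Num 1)) s 1 [] r"
    using exec.Assign[of "Num x" "Num 1" s] by (simp add: r_def)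
  from exec.Seq[OF this s'(1)]
  have "exec (for_loop x y c) s (1 + t) (concat (map F [1..s y])) s'"
    by (simp add: for_loop_def)
  moreover have "1 + t \<le> (B + 10) * m ^ Suc k"
  proof -
    have "nat (s y) * (B * m ^ k + 6) \<le> m * (B * m ^ k + 6)"
      using m by (intro mult_right_mono) auto
    moreover have "m * (B * m ^ k + 6) = B * (m * m ^ k) + 6 * m"
      "(B + 10) * m ^ Suc k = B * (m * m ^ k) + 10 * (m * m ^ k)" by (simp_all add: algebra_simps)
    moreover have "m \<le> m * m ^ k" using m(2) by simp
    ultimately show ?thesis using s'(2) m(2) by linarith
  qed
  moreover have "\<forall>z. z \<notin> insert x V \<longrightarrow> s' z = s z" using s'(3) by (simp add: r_def)
  ultimately show ?thesis unfolding runs_within_def by blast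
qed

fun loop_free :: "com \<Rightarrow> bool" where
  "loop_free (While b c) = False"
| "loop_free (Seq c1 c2) = (loop_free c1 \<and> loop_free c2)"
| "loop_free (Cond b c1 c2) = (loop_free c1 \<and> loop_free c2)"
| "loop_free _ = True"

text \<open>For the innermost body the mere existence of a bound suffices, as the asymptotic running time
  hides its value.\<close>

lemma loop_free_bounded_time: "loop_free c \<Longrightarrow> \<exists>n. \<forall>s t L s'. exec c s t L s' \<longrightarrow> t \<le> n"
proof (induction c)
  case (Seq c1 c2)
  then obtain n1 n2 where "\<And>s t L s'. exec c1 s t L s' \<Longrightarrow> t \<le> n1" "\<And>s t L s'. exec c2 s t L s' \<Longrightarrow> t \<le> n2"
    by auto metis
  then show ?case
    by (intro exI[of _ "n1 + n2"] allI impI, elim exec_elims(3)) (simp add: add_mono)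
next
  case (Cond b c1 c2)
  then obtain n1 n2 where "\<And>s t L s'. exec c1 s t L s' \<Longrightarrow> t \<le> n1" "\<And>s t L s'. exec c2 s t L s' \<Longrightarrow> t \<le> n2"
    by auto metis
  then show ?case
    by (intro exI[of _ "bcost b + max n1 n2"] allI impI, elim exec_elims(4)) (simp_all add: le_max_iff_disj)
qed (auto elim: exec_elims)

section \<open>The programs\<close>

text \<open>The cells 1 to 5 hold \<open>a, b, c, e, f\<close>. The last side is an expression \<open>v\<close>, so that the same
  test of canonicity can be generated for every candidate.\<close>

fun side_exp :: "aexp \<Rightarrow> nat \<Rightarrow> nat \<Rightarrow> aexp" where
  "side_exp v i j =
     (if {i, j} = {0, 1} then Cell (Num 1)
      else if {i, j} = {0, 2} then Cell (Num 2)
      else if {i, j} = {1, 2} then Cell (Num 3)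
      else if {i, j} = {0, 3} then Cell (Num 4)
      else if {i, j} = {1, 3} then Cell (Num 5)
      else if {i, j} = {2, 3} then v
      else Num 0)"

lemma aval_side_exp: "aval (side_exp v i j) s = side (s 1, s 2, s 3, s 4, s 5, aval v s) i j"
  by simp

fun lex_exp :: "aexp list \<Rightarrow> aexp list \<Rightarrow> bexp" where
  "lex_exp (x # xs) (y # ys) =
     Neg (Conj (Neg (Less x y)) (Neg (Conj (Neg (Less y x)) (lex_exp xs ys))))"
| "lex_exp _ _ = Leq (Num 0) (Num 0)"

lemma bval_lex_exp:
  "length xs = length ys \<Longrightarrow> bval (lex_exp xs ys) s \<longleftrightarrow>
     ord_class.lexordp_eq (map (\<lambda>x. aval x s) xs) (map (\<lambda>x. aval x s) ys)"
  by (induction xs ys rule: list_induct2) auto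

definition canonical_exp :: "aexp \<Rightarrow> bexp" where
  "canonical_exp v = foldr Conj (map (\<lambda>(i, j, k, l). lex_exp
     [side_exp v i j, side_exp v i k, side_exp v j k, side_exp v i l, side_exp v j l, side_exp v k l]
     [Cell (Num 1), Cell (Num 2), Cell (Num 3), Cell (Num 4), Cell (Num 5), v]) labellings)
     (Leq (Num 0) (Num 0))"

lemma bval_foldr_Conj: "bval (foldr Conj bs b) s \<longleftrightarrow> (\<forall>c\<in>set bs. bval c s) \<and> bval b s"
  by (induction bs) auto

lemma bval_canonical_exp:
  "bval (canonical_exp v) s \<longleftrightarrow> canonical (s 1, s 2, s 3, s 4, s 5, aval v s)"
  unfolding canonical_labellings canonical_exp_def bval_foldr_Conj
  by (auto simp: bval_lex_exp aval_side_exp simp del: side_exp.simps side.simps lexordp_eq_simps lex_exp.simps)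

definition twice_dot_exp :: "aexp \<Rightarrow> aexp \<Rightarrow> aexp \<Rightarrow> aexp" where
  "twice_dot_exp a b c = Minus (Plus (Times a a) (Times b b)) (Times c c)"

definition heron_exp :: "aexp \<Rightarrow> aexp \<Rightarrow> aexp \<Rightarrow> aexp" where
  "heron_exp a b c = Minus (Times (Times (Num 4) (Times a a)) (Times b b))
     (Times (twice_dot_exp a b c) (twice_dot_exp a b c))"

lemma aval_heron_exp [simp]: "aval (heron_exp a b c) s = heron (aval a s) (aval b s) (aval c s)"
  by (simp add: heron_exp_def twice_dot_exp_def heron_def twice_dot_def power2_eq_square)

definition right_fold_exp :: aexp where
  "right_fold_exp = (let x = Minus (twice_dot_exp (Cell (Num 1)) (Cell (Num 2)) (Cell (Num 3)))
       (twice_dot_exp (Cell (Num 1)) (Cell (Num 4)) (Cell (Num 5)))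
     in Plus (Plus (Times x x) (heron_exp (Cell (Num 1)) (Cell (Num 2)) (Cell (Num 3))))
       (heron_exp (Cell (Num 1)) (Cell (Num 4)) (Cell (Num 5))))"

definition fold_radius_exp :: aexp where
  "fold_radius_exp = Sqrt (Minus (Times (Times (Num 4)
     (heron_exp (Cell (Num 1)) (Cell (Num 2)) (Cell (Num 3))))
     (heron_exp (Cell (Num 1)) (Cell (Num 4)) (Cell (Num 5)))) (Num 1))"

definition min_side_exp :: aexp where
  "min_side_exp = Plus (Sqrt (Quot (Minus (Minus right_fold_exp fold_radius_exp) (Num 1))
     (Times (Num 4) (Times (Cell (Num 1)) (Cell (Num 1)))))) (Num 1)"

definition max_side_exp :: aexp where
  "max_side_exp = Sqrt (Quot (Plus right_fold_exp fold_radius_exp)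
     (Times (Num 4) (Times (Cell (Num 1)) (Cell (Num 1)))))"

lemma aval_right_fold_exp: "aval right_fold_exp s = right_fold (s 1) (s 2) (s 3) (s 4) (s 5)"
  by (simp add: right_fold_exp_def twice_dot_exp_def Let_def right_fold_def twice_dot_def power2_eq_square)

lemma aval_fold_radius_exp: "aval fold_radius_exp s = fold_radius (s 1) (s 2) (s 3) (s 4) (s 5)"
  by (simp add: fold_radius_exp_def fold_radius_def)

lemma aval_min_side_exp: "aval min_side_exp s = min_side (s 1) (s 2) (s 3) (s 4) (s 5)"
  by (simp add: min_side_exp_def min_side_def aval_right_fold_exp aval_fold_radius_exp power2_eq_square)

lemma aval_max_side_exp: "aval max_side_exp s = max_side (s 1) (s 2) (s 3) (s 4) (s 5)"
  by (simp add: max_side_exp_def max_side_def aval_right_fold_exp aval_fold_radius_exp power2_eq_square)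

definition candidate_exps :: "aexp list" where
  "candidate_exps = max_side_exp #
     map (\<lambda>i. Cell (Num i)) [1..5] @ map (\<lambda>i. Minus (Cell (Num i)) (Num 1)) [1..5]"

lemma set_1_to_5: "{1..5} = {1, 2, 3, 4, 5::int}" by auto

lemma candidate_exps_values:
  "(\<lambda>v. aval v s) ` set candidate_exps = bound_candidates (s 1) (s 2) (s 3) (s 4) (s 5)"
  unfolding candidate_exps_def bound_candidates_def
  by (simp add: aval_max_side_exp image_Un image_image set_1_to_5 insert_commute)

text \<open>The candidates do not read cell 6 and keep their values while the maximum is being updated.\<close>

lemma candidate_exps_update: "v \<in> set candidate_exps \<Longrightarrow> aval v (s(6 := x)) = aval v s"
  by (auto simp: candidate_exps_def aval_max_side_exp)

text \<open>Cell 6 collects the maximum of the candidates that pass the test.\<close>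

fun raise_bound :: "aexp list \<Rightarrow> com" where
  "raise_bound [] = Skip"
| "raise_bound (v # vs) = Seq
     (Cond (Conj (Less (Cell (Num 6)) v) (Conj (Leq v max_side_exp) (canonical_exp v)))
       (Assign (Num 6) v) Skip)
     (raise_bound vs)"

definition feasible :: "store \<Rightarrow> int \<Rightarrow> bool" where
  "feasible s v \<longleftrightarrow> v \<le> max_side (s 1) (s 2) (s 3) (s 4) (s 5) \<and> canonical (s 1, s 2, s 3, s 4, s 5, v)"

lemma feasible_update: "feasible (s(6 := n)) = feasible s"
  by (simp add: feasible_def fun_eq_iff)

lemma raise_bound_exec:
  assumes "set vs \<subseteq> set candidate_exps"
  shows "\<exists>t m. exec (raise_bound vs) s t [] (s(6 := m)) \<and>
    m \<in> insert (s 6) {v \<in> (\<lambda>v. aval v s) ` set vs. feasible s v} \<and>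
    (\<forall>v\<in>insert (s 6) {v \<in> (\<lambda>v. aval v s) ` set vs. feasible s v}. v \<le> m)"
  using assms
proof (induction vs arbitrary: s)
  case Nil
  show ?case
    by (intro exI[of _ 0] exI[of _ "s 6"] conjI) (simp_all add: exec.Skip)
next
  case (Cons v vs)
  let ?w = "aval v s"
  let ?test = "Conj (Less (Cell (Num 6)) v) (Conj (Leq v max_side_exp) (canonical_exp v))"
  define n where "n = (if s 6 < ?w \<and> feasible s ?w then ?w else s 6)"
  have test: "bval ?test s \<longleftrightarrow> s 6 < ?w \<and> feasible s ?w"
    by (simp add: bval_canonical_exp aval_max_side_exp feasible_def)
  have "\<exists>t. exec (Cond ?test (Assign (Num 6) v) Skip) s t [] (s(6 := n))"
  proof (cases "bval ?test s")
    case True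
    then have "n = ?w" unfolding n_def test by simp
    then have "exec (Assign (Num 6) v) s (acost v + 1) [] (s(6 := n))"
      using exec.Assign[of "Num 6" v s] by simp
    with True show ?thesis by (blast intro: exec.CondTrue)
  next
    case False
    then have "s(6 := n) = s" unfolding n_def test by auto
    with False show ?thesis by (metis exec.CondFalse exec.Skip)
  qed
  then obtain t1 where t1: "exec (Cond ?test (Assign (Num 6) v) Skip) s t1 [] (s(6 := n))" ..
  have vals: "(\<lambda>v. aval v (s(6 := n))) ` set vs = (\<lambda>v. aval v s) ` set vs"
    using Cons.prems by (intro image_cong refl candidate_exps_update) auto
  have "set vs \<subseteq> set candidate_exps" using Cons.prems by simp
  from Cons.IH[OF this, of "s(6 := n)"]
  obtain t2 m where m: "exec (raise_bound vs) (s(6 := n)) t2 [] (s(6 := m))"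
    "m \<in> insert n {v \<in> (\<lambda>v. aval v s) ` set vs. feasible s v}"
    "\<forall>v\<in>insert n {v \<in> (\<lambda>v. aval v s) ` set vs. feasible s v}. v \<le> m"
    unfolding vals feasible_update fun_upd_upd fun_upd_same by (elim exE conjE)
  from exec.Seq[OF t1 m(1)] have "exec (raise_bound (v # vs)) s (t1 + t2) [] (s(6 := m))" by simp
  moreover have "m \<in> insert (s 6) {x \<in> (\<lambda>v. aval v s) ` set (v # vs). feasible s x}"
    using m(2) unfolding n_def by (auto split: if_splits)
  moreover have "\<forall>x\<in>insert (s 6) {x \<in> (\<lambda>v. aval v s) ` set (v # vs). feasible s x}. x \<le> m"
    using m(3) unfolding n_def by (auto split: if_splits)
  ultimately show ?case by blast
qed

definition print_entry :: com where
  "print_entry = Cond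
     (Conj (Less (Num 0) (heron_exp (Cell (Num 1)) (Cell (Num 2)) (Cell (Num 3))))
           (Less (Num 0) (heron_exp (Cell (Num 1)) (Cell (Num 4)) (Cell (Num 5)))))
     (Seq (Assign (Num 6) (Num 0)) (Seq (raise_bound candidate_exps)
       (Print (Cell (Num 1)) (Cell (Num 2)) (Cell (Num 3)) (Cell (Num 4)) (Cell (Num 5))
          min_side_exp (Cell (Num 6)))))
     Skip"

lemma print_entry_exec:
  "\<exists>t m. exec print_entry s t (entries (s 1) (s 2) (s 3) (s 4) (s 5)) (s(6 := m))"
proof (cases "heron (s 1) (s 2) (s 3) > 0 \<and> heron (s 1) (s 4) (s 5) > 0")
  case True
  let ?s = "s(6 := 0)"
  let ?S = "{v \<in> bound_candidates (s 1) (s 2) (s 3) (s 4) (s 5). feasible s v}"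
  have vals: "(\<lambda>v. aval v ?s) ` set candidate_exps = bound_candidates (s 1) (s 2) (s 3) (s 4) (s 5)"
    unfolding candidate_exps_values by simp
  from raise_bound_exec[OF subset_refl, of ?s] obtain t m where
    m: "exec (raise_bound candidate_exps) ?s t [] (s(6 := m))" "m \<in> insert 0 ?S" "\<forall>v\<in>insert 0 ?S. v \<le> m"
    unfolding vals feasible_update fun_upd_upd fun_upd_same by (elim exE conjE)
  have "finite ?S" by (simp add: bound_candidates_def)
  then have "Max (insert 0 ?S) = m"
    using m(2,3) by (intro Max_eqI) auto
  then have m_eq: "m = upper_bound (s 1) (s 2) (s 3) (s 4) (s 5)"
    unfolding upper_bound_def feasible_def by simp
  let ?print = "Print (Cell (Num 1)) (Cell (Num 2)) (Cell (Num 3)) (Cell (Num 4)) (Cell (Num 5))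
    min_side_exp (Cell (Num 6))"
  have "exec (Assign (Num 6) (Num 0)) s 1 [] ?s"
    using exec.Assign[of "Num 6" "Num 0" s] by simp
  moreover obtain u where "exec ?print (s(6 := m)) u (entries (s 1) (s 2) (s 3) (s 4) (s 5)) (s(6 := m))"
    using exec.Print[of "Cell (Num 1)" "Cell (Num 2)" "Cell (Num 3)" "Cell (Num 4)" "Cell (Num 5)"
      min_side_exp "Cell (Num 6)" "s(6 := m)"] True
    by (simp add: entries_def aval_min_side_exp m_eq)
  ultimately have "exec (Seq (Assign (Num 6) (Num 0)) (Seq (raise_bound candidate_exps) ?print)) s
      (1 + (t + u)) ([] @ [] @ entries (s 1) (s 2) (s 3) (s 4) (s 5)) (s(6 := m))"
    using m(1) by (intro exec.Seq)
  then have "exec (Seq (Assign (Num 6) (Num 0)) (Seq (raise_bound candidate_exps) ?print)) s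
      (1 + (t + u)) (entries (s 1) (s 2) (s 3) (s 4) (s 5)) (s(6 := m))" by simp
  moreover have "bval (Conj (Less (Num 0) (heron_exp (Cell (Num 1)) (Cell (Num 2)) (Cell (Num 3))))
      (Less (Num 0) (heron_exp (Cell (Num 1)) (Cell (Num 4)) (Cell (Num 5))))) s"
    using True by simp
  ultimately show ?thesis unfolding print_entry_def by (blast intro: exec.CondTrue)
next
  case False
  then have "exec print_entry s (bcost (Conj (Less (Num 0) (heron_exp (Cell (Num 1)) (Cell (Num 2)) (Cell (Num 3))))
           (Less (Num 0) (heron_exp (Cell (Num 1)) (Cell (Num 4)) (Cell (Num 5))))) + 0) [] s"
    unfolding print_entry_def by (intro exec.CondFalse exec.Skip) auto
  then show ?thesis using False by (auto simp: entries_def intro!: exI[of _ "s 6"])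
qed

lemma print_entry_runs_within:
  "\<exists>B. \<forall>s. runs_within print_entry s B (entries (s 1) (s 2) (s 3) (s 4) (s 5)) {6}"
proof -
  have "loop_free (raise_bound vs)" for vs by (induction vs) auto
  then have "loop_free print_entry" by (simp add: print_entry_def)
  from loop_free_bounded_time[OF this] obtain B where
    B: "\<And>s t L s'. exec print_entry s t L s' \<Longrightarrow> t \<le> B" by blast
  have "runs_within print_entry s B (entries (s 1) (s 2) (s 3) (s 4) (s 5)) {6}" for s
  proof -
    obtain t m where *: "exec print_entry s t (entries (s 1) (s 2) (s 3) (s 4) (s 5)) (s(6 := m))"
      using print_entry_exec by blast
    then show ?thesis unfolding runs_within_def using B[OF *] by fastforce
  qed
  then show ?thesis by blast
qed

definition print_diameter :: com where
  "print_diameter = for_loop 2 1 (for_loop 3 1 (for_loop 4 1 (for_loop 5 1 print_entry)))"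

lemma print_diameter_runs_within:
  "\<exists>B. \<forall>s m. s 1 \<le> int m \<and> 1 \<le> m \<longrightarrow>
     runs_within print_diameter s (B * m ^ 4) (entries_with_diameter (s 1)) {2, 3, 4, 5, 6}"
proof -
  obtain B where B: "\<And>s. runs_within print_entry s B (entries (s 1) (s 2) (s 3) (s 4) (s 5)) {6}"
    using print_entry_runs_within by blast
  have "runs_within print_diameter s ((B + 40) * m ^ 4) (entries_with_diameter (s 1)) {2, 3, 4, 5, 6}"
    if m: "s 1 \<le> int m" "1 \<le> m" for s :: store and m
  proof -
    have 1: "runs_within (for_loop 5 1 print_entry) s ((B + 10) * m ^ 1)
        (concat (map (\<lambda>f. entries (s 1) (s 2) (s 3) (s 4) f) [1..s 1])) {5, 6}"
      if "s 1 \<le> int m" for s :: store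
      unfolding One_nat_def
    proof (rule for_loop_runs_within[where k = 0])
      fix r :: store assume "\<forall>z. z \<notin> {5, 6} \<longrightarrow> r z = s z"
      then show "runs_within print_entry r (B * m ^ 0) (entries (s 1) (s 2) (s 3) (s 4) (r 5)) {6}"
        using B[of r] by simp
    qed (use that m in simp_all)
    have 2: "runs_within (for_loop 4 1 (for_loop 5 1 print_entry)) s ((B + 10 + 10) * m ^ Suc 1)
        (concat (map (\<lambda>e. concat (map (\<lambda>f. entries (s 1) (s 2) (s 3) e f) [1..s 1])) [1..s 1])) {4, 5, 6}"
      if "s 1 \<le> int m" for s :: store
    proof (rule for_loop_runs_within)
      fix r :: store assume "\<forall>z. z \<notin> {4, 5, 6} \<longrightarrow> r z = s z"
      then show "runs_within (for_loop 5 1 print_entry) r ((B + 10) * m ^ 1)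
        (concat (map (\<lambda>f. entries (s 1) (s 2) (s 3) (r 4) f) [1..s 1])) {5, 6}"
        using 1[of r] that by simp
    qed (use that m in simp_all)
    have 3: "runs_within (for_loop 3 1 (for_loop 4 1 (for_loop 5 1 print_entry))) s ((B + 10 + 10 + 10) * m ^ Suc (Suc 1))
        (concat (map (\<lambda>c. concat (map (\<lambda>e. concat (map (\<lambda>f. entries (s 1) (s 2) c e f) [1..s 1])) [1..s 1])) [1..s 1])) {3, 4, 5, 6}"
      if "s 1 \<le> int m" for s :: store
    proof (rule for_loop_runs_within)
      fix r :: store assume "\<forall>z. z \<notin> {3, 4, 5, 6} \<longrightarrow> r z = s z"
      then show "runs_within (for_loop 4 1 (for_loop 5 1 print_entry)) r ((B + 10 + 10) * m ^ Suc 1)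
        (concat (map (\<lambda>e. concat (map (\<lambda>f. entries (s 1) (s 2) (r 3) e f) [1..s 1])) [1..s 1])) {4, 5, 6}"
        using 2[of r] that by simp
    qed (use that m in simp_all)
    have "runs_within print_diameter s ((B + 10 + 10 + 10 + 10) * m ^ Suc (Suc (Suc 1))) (entries_with_diameter (s 1)) {2, 3, 4, 5, 6}"
      unfolding print_diameter_def entries_with_diameter_def
    proof (rule for_loop_runs_within)
      fix r :: store assume "\<forall>z. z \<notin> {2, 3, 4, 5, 6} \<longrightarrow> r z = s z"
      then show "runs_within (for_loop 3 1 (for_loop 4 1 (for_loop 5 1 print_entry))) r ((B + 10 + 10 + 10) * m ^ Suc (Suc 1))
        (concat (map (\<lambda>c. concat (map (\<lambda>e. concat (map (\<lambda>f. entries (s 1) (r 2) c e f) [1..s 1])) [1..s 1])) [1..s 1])) {3, 4, 5, 6}"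
        using 3[of r] m by simp
    qed (use m in simp_all)
    moreover have "Suc (Suc (Suc 1)) = 4" by simp
    ultimately show ?thesis by (simp only: add.assoc) simp
  qed
  then show ?thesis by blast
qed

lemma outputs_of_runs_within:
  assumes "\<And>d. d \<ge> 1 \<Longrightarrow> runs_within P ((\<lambda>_. 0)(0 := int d)) (B * d ^ k) (L d) V"
  obtains T where "(\<lambda>d. real (T d)) \<in> O(\<lambda>d. real d ^ k)" "\<And>d. d \<ge> 1 \<Longrightarrow> outputs P d (T d) (L d)"
proof -
  have "\<forall>d. \<exists>t. d \<ge> 1 \<longrightarrow> outputs P d t (L d) \<and> t \<le> B * d ^ k"
    using assms unfolding runs_within_def outputs_def by blast
  then obtain T where T: "\<And>d. d \<ge> 1 \<Longrightarrow> outputs P d (T d) (L d) \<and> T d \<le> B * d ^ k"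
    by metis
  have "eventually (\<lambda>d. norm (real (T d)) \<le> real B * norm (real d ^ k)) at_top"
    using eventually_ge_at_top[of 1]
  proof eventually_elim
    case (elim d)
    then have "real (T d) \<le> real (B * d ^ k)" using T by (simp only: of_nat_le_iff)
    then show ?case by simp
  qed
  then have "(\<lambda>d. real (T d)) \<in> O(\<lambda>d. real d ^ k)" by (rule bigoI)
  with T show thesis by (intro that) auto
qed

theorem mainTheorem3:
  shows "(\<exists>(P :: com) (T :: nat \<Rightarrow> nat).
           (\<lambda>d. real (T d)) \<in> O(\<lambda>d. real d ^ 4) \<and>
           (\<forall>d\<ge>1. \<exists>L. outputs P d (T d) L \<and>
              complete_implicit_list L
                {\<delta>. integral_tetrahedron \<delta> \<and> canonical \<delta> \<and> tetra_diameter \<delta> = int d} \<and>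
              represents_classes_once L
                {\<delta>. integral_tetrahedron \<delta> \<and> tetra_diameter \<delta> = int d})) \<and>
         (\<exists>(P :: com) (T :: nat \<Rightarrow> nat).
           (\<lambda>d. real (T d)) \<in> O(\<lambda>d. real d ^ 5) \<and>
           (\<forall>d\<ge>1. \<exists>L. outputs P d (T d) L \<and>
              complete_implicit_list L
                {\<delta>. integral_tetrahedron \<delta> \<and> canonical \<delta> \<and> tetra_diameter \<delta> \<le> int d} \<and>
              represents_classes_once L
                {\<delta>. integral_tetrahedron \<delta> \<and> tetra_diameter \<delta> \<le> int d}))"
proof -
  obtain B where B: "\<And>s m. s 1 \<le> int m \<Longrightarrow> 1 \<le> m \<Longrightarrow>
     runs_within print_diameter s (B * m ^ 4) (entries_with_diameter (s 1)) {2, 3, 4, 5, 6}"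
    using print_diameter_runs_within by blast
  define P1 where "P1 = Seq (Assign (Num 1) (Cell (Num 0))) print_diameter"
  define P2 where "P2 = for_loop 1 0 print_diameter"
  have 1: "runs_within P1 ((\<lambda>_. 0)(0 := int d)) ((B + 2) * d ^ 4) (entries_with_diameter (int d)) {1, 2, 3, 4, 5, 6}"
    if "d \<ge> 1" for d
  proof -
    let ?s = "(\<lambda>_. 0)(0 := int d) :: store"
    have copy: "exec (Assign (Num 1) (Cell (Num 0))) ?s 2 [] (?s(1 := int d))"
      using exec.Assign[of "Num 1" "Cell (Num 0)" ?s] by (simp add: numeral_2_eq_2)
    have "runs_within print_diameter (?s(1 := int d)) (B * d ^ 4)
        (entries_with_diameter (int d)) {2, 3, 4, 5, 6}"
      using B[of "?s(1 := int d)" d] that by simp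
    then obtain t s' where s': "exec print_diameter (?s(1 := int d)) t (entries_with_diameter (int d)) s'"
      "t \<le> B * d ^ 4" "\<forall>z. z \<notin> {2, 3, 4, 5, 6} \<longrightarrow> s' z = (?s(1 := int d)) z"
      unfolding runs_within_def by (elim exE conjE)
    from exec.Seq[OF copy s'(1)] have "exec P1 ?s (2 + t) (entries_with_diameter (int d)) s'"
      by (simp add: P1_def)
    moreover have "2 + t \<le> (B + 2) * d ^ 4"
      using s'(2) one_le_power[OF that, of 4] unfolding add_mult_distrib by linarith
    moreover have "\<forall>z. z \<notin> {1, 2, 3, 4, 5, 6} \<longrightarrow> s' z = ?s z" using s'(3) by simp
    ultimately show ?thesis unfolding runs_within_def by blast
  qed
  have 2: "runs_within P2 ((\<lambda>_. 0)(0 := int d)) ((B + 10) * d ^ 5)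
      (concat (map entries_with_diameter [1..int d])) {1, 2, 3, 4, 5, 6}"
    if "d \<ge> 1" for d
  proof -
    let ?s = "(\<lambda>_. 0)(0 := int d) :: store"
    have "runs_within (for_loop 1 0 print_diameter) ?s ((B + 10) * d ^ Suc 4)
      (concat (map entries_with_diameter [1..?s 0])) {1, 2, 3, 4, 5, 6}"
    proof (rule for_loop_runs_within)
      fix r :: store assume "r 1 \<le> ?s 0"
      then show "runs_within print_diameter r (B * d ^ 4) (entries_with_diameter (r 1)) {2, 3, 4, 5, 6}"
        using B[of r d] that by simp
    qed (use that in simp_all)
    then show ?thesis by (simp add: P2_def)
  qed
  obtain T1 where T1: "(\<lambda>d. real (T1 d)) \<in> O(\<lambda>d. real d ^ 4)"
    "\<And>d. d \<ge> 1 \<Longrightarrow> outputs P1 d (T1 d) (entries_with_diameter (int d))"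
    using outputs_of_runs_within[OF 1] by blast
  obtain T2 where T2: "(\<lambda>d. real (T2 d)) \<in> O(\<lambda>d. real d ^ 5)"
    "\<And>d. d \<ge> 1 \<Longrightarrow> outputs P2 d (T2 d) (concat (map entries_with_diameter [1..int d]))"
    using outputs_of_runs_within[OF 2] by blast
  note once1 = represents_classes_once_canonical[of _ "\<lambda>n. n = int d" for d, OF list_of_diameter]
  note once2 = represents_classes_once_canonical[of _ "\<lambda>n. n \<le> int d" for d, OF list_up_to_diameter]
  show ?thesis
  proof (rule conjI, goal_cases)
    case 1
    show ?case
      by (rule exI[of _ P1], rule exI[of _ T1],
          intro conjI allI impI exI[of _ "entries_with_diameter (int d)" for d])
        (rule T1(1), erule T1(2), rule list_of_diameter, rule once1)
  next
    case 2
    show ?case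
      by (rule exI[of _ P2], rule exI[of _ T2],
          intro conjI allI impI exI[of _ "concat (map entries_with_diameter [1..int d])" for d])
        (rule T2(1), erule T2(2), rule list_up_to_diameter, rule once2)
  qed
qed

end
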